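(* Let $F$ be a finite field of characteristic $p$ with $|F|=q=p^k$ and let $G=C_3 \rtimes C_8$. If $p>3$, then $$U(FG) \cong \begin{cases} C_{p^k-1}^8 \times GL(2,F)^4, & \text{if } q \equiv 1 \text{ or } -7 \bmod 24;\\ C_{p^k-1}^2 \times C_{p^{2k}-1}^{3} \times GL(2, F)^2 \times GL(2, F_2), & \text{if } q \equiv -1, -5, 7 \text{ or } 11 \bmod 24;\\ C_{p^k-1}^4 \times C_{p^{2k}-1}^2 \times GL(2,F)^4, & \text{if } q \equiv 5 \text{ or } -11 \bmod 24.\end{cases}$$
   Context: $FG$ denotes the group algebra of a finite group $G$ over $F$, and $U(FG)$ its group of units. $C_n$ is the cyclic group of order $n$, and $H^m$ denotes the direct product of $m$ copies of a group $H$. $F_2$ denotes the extension field of $F$ of degree $2$ (so $|F_2|=q^2$). The group $C_3 \rtimes C_8$ is the group of order $24$ with presentation $\langle x, y \mid x^{3}=y^8=1,\ yxy^{-1}=x^{-1} \rangle$. *)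

theory Defs
  imports
    "HOL-Algebra.Algebra"
    "HOL-Library.Cardinality"
    "HOL-Number_Theory.Cong"
    "Jordan_Normal_Form.Matrix"
begin

text \<open>The group algebra of a finite group over a commutative ring given by a type class.
  Its elements are the coefficient functions that vanish outside the carrier of the group, and
  multiplication is convolution.\<close>

definition group_algebra :: "'f::comm_ring_1 itself \<Rightarrow> ('g, 'm) monoid_scheme \<Rightarrow> ('g \<Rightarrow> 'f) ring"
  where "group_algebra F G =
    \<lparr>carrier = {a. \<forall>g. g \<notin> carrier G \<longrightarrow> a g = 0},
     monoid.mult = (\<lambda>a b z. \<Sum>(g, h) \<in> {(g, h). g \<in> carrier G \<and> h \<in> carrier G \<and> g \<otimes>\<^bsub>G\<^esub> h = z}. a g * b h),
     one = (\<lambda>z. if z = \<one>\<^bsub>G\<^esub> then 1 else 0),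
     ring.zero = (\<lambda>z. 0),
     ring.add = (\<lambda>a b z. a z + b z)\<rparr>"

definition general_linear_group :: "nat \<Rightarrow> 'f::field itself \<Rightarrow> 'f mat monoid"
  where "general_linear_group n F = units_of (ring_mat F n ())"

definition group_power :: "('g, 'm) monoid_scheme \<Rightarrow> nat \<Rightarrow> (nat \<Rightarrow> 'g) monoid"
  where "group_power H m = product_group {..<m} (\<lambda>_. H)"

text \<open>The group with presentation
  \<open>\<langle>x, y | x\<^sup>3 = y\<^sup>8 = 1, y x y\<^sup>-\<^sup>1 = x\<^sup>-\<^sup>1\<rangle>\<close>. A group generated by elements satisfying these relations
  is a quotient of the presented group, which has order 24; so the condition on the order says
  exactly that the quotient map is an isomorphism.\<close>

definition is_C3_rtimes_C8 :: "('g, 'm) monoid_scheme \<Rightarrow> bool"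
  where "is_C3_rtimes_C8 G \<longleftrightarrow>
    group G \<and> Coset.order G = 24 \<and>
    (\<exists>x \<in> carrier G. \<exists>y \<in> carrier G.
       generate G {x, y} = carrier G \<and>
       x [^]\<^bsub>G\<^esub> (3::nat) = \<one>\<^bsub>G\<^esub> \<and> y [^]\<^bsub>G\<^esub> (8::nat) = \<one>\<^bsub>G\<^esub> \<and>
       y \<otimes>\<^bsub>G\<^esub> x \<otimes>\<^bsub>G\<^esub> inv\<^bsub>G\<^esub> y = inv\<^bsub>G\<^esub> x)"

text \<open>The embedding \<open>\<iota>\<close> makes the field \<open>'e\<close> an extension of the field \<open>'f\<close> of degree \<open>d\<close>. For
  \<open>d > 0\<close> this includes finiteness of the degree, as the library's dimension of an
  infinite-dimensional space is 0.\<close>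

definition is_extension_of_degree :: "nat \<Rightarrow> ('f::field \<Rightarrow> 'e::field) \<Rightarrow> bool"
  where "is_extension_of_degree d \<iota> \<longleftrightarrow>
    field_hom \<iota> \<and> vector_space.dim (\<lambda>a v. \<iota> a * v) (UNIV :: 'e set) = d"

end

(* The characters of G trivial on x are y |-> z with z^8 = 1. The remaining irreducible representations
   over an algebraically closed field are two-dimensional; they are indexed by the scalars c with
   c^4 = 1 by which the central element y^2 acts, and each is defined over F(c) because over a finite field
   c is represented by the binary form a^2 - a d + d^2. A set of representatives of the Frobenius orbits of
   the z and of the c therefore gives a multiplicative map from FG to a product of copies of F, of its
   quadratic extension and of their 2 x 2 matrix rings. If all values of an element vanish, then so do
   the conjugate ones, and polynomials of degree < 8 and < 4 with too many roots show that the
   element is 0. Since both sides have q^24 elements, the map is bijective, and one passes to units. *)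

theory Submission
  imports Defs "HOL-Algebra.Algebraic_Closure_Type"
begin

subsection \<open>Finite fields\<close>

text \<open>The obstacle is splitting. A two-dimensional irreducible representation with y^2 = c
  lives on the quaternion algebra generated by u and v with u^2 + u + 1 = 0, v u = u^2 v and v^2 =
  c. A solution of a^2 - a d + d^2 = c turns it into 2 x 2 matrices over F(c), whether or not F(c)
  contains a primitive cube root of unity. So the cases are governed by q modulo 8 alone, that is,
  by which eighth roots of unity lie in F. The assumption p > 3 acts mainly through 2 and 3 being
  nonzero: 2 separates the powers of a root of t^4 = -1; 3 makes 1, u, v, u v independent and is
  cancelled at the end, when three equal coefficients have sum 0. For q = 5 modulo 8 the statement
  supplies no quadratic extension, so one is built inside the algebraic closure of F. This is why
  units are computed for subsets of a field type.\<close>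

lemma finite_field_fermat:
  fixes z :: "'k::field"
  assumes "finite (UNIV :: 'k set)" and "z \<noteq> 0"
  shows "z ^ (CARD('k) - 1) = 1"
proof -
  have "(\<Prod>y\<in>UNIV-{0}. z * y) = z ^ (CARD('k) - 1) * \<Prod>(UNIV-{0})"
    by (subst prod.distrib) (simp add: assms(1) card_Diff_singleton)
  moreover have "(\<Prod>y\<in>UNIV-{0}. z * y) = \<Prod>(UNIV-{0})"
    by (rule prod.reindex_bij_witness[of _ "\<lambda>y. y / z" "\<lambda>y. z * y"]) (use assms in auto)
  moreover have "\<Prod>(UNIV-{0::'k}) \<noteq> 0" using assms(1) by simp
  ultimately show ?thesis by simp
qed

text \<open>Finiteness is a hypothesis and not a sort, because the extension field of the theorem
  has only sort \<open>field\<close>; its finiteness is derived from its degree.\<close>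

lemma finite_field_power_card:
  fixes z :: "'k::field"
  assumes "finite (UNIV :: 'k set)"
  shows "z ^ CARD('k) = z"
proof (cases "z = 0")
  case True
  then show ?thesis using finite_UNIV_card_ge_0[OF assms] by simp
next
  case False
  have "z ^ CARD('k) = z * z ^ (CARD('k) - 1)"
    using finite_UNIV_card_ge_0[OF assms] by (metis power_eq_if less_numeral_extra(3))
  then show ?thesis using finite_field_fermat[OF assms False] by simp
qed

text \<open>A nonzero polynomial of degree below \<open>n\<close> has fewer than \<open>n\<close>
  roots. Injectivity of the decomposition rests on this, with \<open>n\<close> = 8 for the
  characters and \<open>n\<close> = 4 for the scalars c.\<close>

lemma coeffs_eq_0_if_many_roots:
  fixes c :: "nat \<Rightarrow> 'k::idom"
  assumes roots: "\<And>z. z \<in> Z \<Longrightarrow> (\<Sum>j<n. c j * z ^ j) = 0"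
    and "finite Z" "n \<le> card Z" "j < n"
  shows "c j = 0"
proof -
  define P where "P = (\<Sum>j<n. monom (c j) j)"
  have coeff: "coeff P i = (if i < n then c i else 0)" for i
    by (auto simp: P_def coeff_sum)
  have "P = 0"
  proof (rule ccontr)
    assume "P \<noteq> 0"
    have "degree P < n"
      using coeff \<open>P \<noteq> 0\<close> by (metis leading_coeff_0_iff)
    moreover have "Z \<subseteq> {z. poly P z = 0}"
      using roots by (auto simp: P_def poly_sum poly_monom)
    then have "card Z \<le> card {z. poly P z = 0}"
      by (simp add: \<open>P \<noteq> 0\<close> card_mono poly_roots_finite)
    moreover have "card {z. poly P z = 0} \<le> degree P"
      using \<open>P \<noteq> 0\<close> by (rule card_poly_roots_bound)
    ultimately show False using assms(3) by linarith
  qed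
  then show ?thesis using coeff[of j] \<open>j < n\<close> by simp
qed

lemma ex_half_power_eq_minus_1:
  assumes fin: "finite (UNIV :: 'k::field set)" and m: "CARD('k) - 1 = 2 * m" "m > 0"
  shows "\<exists>z::'k. z ^ m = -1"
proof -
  have "\<exists>z::'k. z \<noteq> 0 \<and> z ^ m \<noteq> 1"
  proof (rule ccontr)
    assume "\<not> ?thesis"
    then have all: "z ^ m = 1" if "z \<noteq> 0" for z :: 'k using that by blast
    \<comment> \<open>These are the coefficients of t^m - 1, which cannot vanish at all 2 m nonzero
      elements. As m > 0, the two nonzero coefficients sit at different places.\<close>
    define c :: "nat \<Rightarrow> 'k" where "c j = (if j = m then 1 else if j = 0 then -1 else 0)" for j
    have "(\<Sum>j<Suc m. c j * z ^ j) = z ^ m - 1" for z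
    proof -
      have "(\<Sum>j<Suc m. c j * z ^ j) = (\<Sum>j\<in>{0,m}. c j * z ^ j)"
        by (intro sum.mono_neutral_right) (auto simp: c_def)
      then show ?thesis using m(2) by (simp add: c_def)
    qed
    then have root: "(\<Sum>j<Suc m. c j * z ^ j) = 0" if "z \<noteq> 0" for z
      using all[OF that] by (metis diff_self)
    have "c m = 0"
    proof (rule coeffs_eq_0_if_many_roots[where Z = "UNIV - {0}" and n = "Suc m"])
      show "Suc m \<le> card (UNIV - {0::'k})" using m by (simp add: fin card_Diff_singleton)
    qed (use root fin in \<open>simp_all del: sum.lessThan_Suc\<close>)
    then show False by (simp add: c_def)
  qed
  then obtain z :: 'k where "z \<noteq> 0" "z ^ m \<noteq> 1" by blast
  then have "(z ^ m) ^ 2 = 1"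
    using finite_field_fermat[OF fin, of z] m by (simp add: power_mult[symmetric] mult.commute)
  with \<open>z ^ m \<noteq> 1\<close> show ?thesis by (auto simp: power2_eq_1_iff)
qed

text \<open>Pigeonhole on 4 (a^2 - a d + d^2) = (2 a - d)^2 + 3 d^2: more than half of the field
  consists of squares, so the set of squares meets its image under the injection t -> 4 c - 3
  t.\<close>

lemma norm_form_eisenstein_surj:
  fixes c :: "'k::field"
  assumes fin: "finite (UNIV :: 'k set)" and two: "(2::'k) \<noteq> 0" and three: "(3::'k) \<noteq> 0"
  shows "\<exists>a d. a * a - a * d + d * d = c"
proof -
  let ?n = "CARD('k)"
  define Q where "Q = range (\<lambda>s::'k. s * s)"
  define Q' where "Q' = (\<lambda>t. 4 * c - 3 * t) ` Q"
  have finQ: "finite Q" using fin by (simp add: Q_def)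
  \<comment> \<open>A nonzero square has at most two roots, so at least (n - 1) / 2 squares are
    nonzero; the square 0 gives the strict inequality.\<close>
  have cardQ: "?n < 2 * card Q"
  proof -
    have "UNIV - {0::'k} = (\<Union>t\<in>Q-{0}. {s. s * s = t})" by (auto simp: Q_def)
    then have "?n - 1 = card (\<Union>t\<in>Q-{0}. {s::'k. s * s = t})"
      by (metis card_Diff_singleton UNIV_I)
    also have "\<dots> \<le> (\<Sum>t\<in>Q-{0}. card {s::'k. s * s = t})"
      by (rule card_UN_le) (simp add: finQ)
    also have "\<dots> \<le> (\<Sum>t\<in>Q-{0}. 2)"
    proof (rule sum_mono)
      fix t assume "t \<in> Q - {0}"
      then obtain s where "t = s * s" by (auto simp: Q_def)
      then have "{s. s * s = t} \<subseteq> {s, -s}" by (auto simp: square_eq_iff)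
      then show "card {s. s * s = t} \<le> 2"
        by (rule order_trans[OF card_mono, rotated]) (auto simp: card_insert_if)
    qed
    also have "\<dots> = 2 * (card Q - 1)"
      using finQ by (simp add: card_Diff_singleton Q_def image_iff)
    finally have "?n - 1 \<le> 2 * (card Q - 1)" .
    moreover have "card Q > 0" using finQ by (auto simp: card_gt_0_iff Q_def)
    moreover have "?n > 0" using fin by (simp add: finite_UNIV_card_ge_0)
    ultimately show ?thesis by linarith
  qed
    have "card Q' = card Q"
      unfolding Q'_def by (rule card_image) (rule inj_onI, use three in simp)
    have "Q \<inter> Q' \<noteq> {}"
    proof
      assume "Q \<inter> Q' = {}"
      then have "card (Q \<union> Q') = 2 * card Q"
        using \<open>card Q' = card Q\<close> finQ by (simp add: card_Un_disjoint Q'_def)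
      moreover have "card (Q \<union> Q') \<le> ?n" by (simp add: card_mono fin)
      ultimately show False using cardQ by linarith
    qed
    then obtain s d where sd: "s * s = 4 * c - 3 * (d * d)"
      by (auto simp: Q_def Q'_def)
    \<comment> \<open>Solves s = 2 a - d, undoing the completion of the square.\<close>
    define a where "a = (s + d) / 2"
    have "2 * a = s + d" unfolding a_def using two by simp
    then have "s = 2 * a - d" by (simp add: algebra_simps)
    then have "(2 * a - d) * (2 * a - d) + 3 * (d * d) = 4 * c" using sd by simp
    moreover have "(2 * a - d) * (2 * a - d) + 3 * (d * d) = 4 * (a * a) - 4 * (a * d) + (1 + 3) * (d * d)"
      by (simp only: distrib_right) (simp add: algebra_simps)
    then have "(2 * a - d) * (2 * a - d) + 3 * (d * d) = 4 * (a * a - a * d + d * d)"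
      by (simp add: algebra_simps)
    ultimately have "4 * (a * a - a * d + d * d) = 4 * c" by simp
    moreover have "(4::'k) \<noteq> 0" using two by (metis mult_2_right mult_eq_0_iff numeral_Bit0 mult_2)
    ultimately show ?thesis by (metis mult_left_cancel)
qed

text \<open>Raising to the power q = |F| is additive in characteristic p and fixes the coefficients,
  which come from F. Hence one root per Frobenius orbit has to be evaluated.\<close>

lemma frobenius_conjugate_root:
  fixes \<iota> :: "'f::{field,finite} \<Rightarrow> 'e::field"
  assumes hom: "field_hom \<iota>" and char: "Factorial_Ring.prime CHAR('e)" and card: "CARD('f) = CHAR('e) ^ k"
    and root: "(\<Sum>j<n. \<iota> (c j) * z ^ j) = 0"
  shows "(\<Sum>j<n. \<iota> (c j) * (z ^ CARD('f)) ^ j) = 0"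
proof -
  interpret field_hom \<iota> by fact
  have "(\<Sum>j<n. \<iota> (c j) * (z ^ CARD('f)) ^ j) = (\<Sum>j<n. \<iota> (c j ^ CARD('f)) * (z ^ CARD('f)) ^ j)"
    by (simp add: finite_field_power_card)
  also have "\<dots> = (\<Sum>j<n. (\<iota> (c j) * z ^ j) ^ CARD('f))"
    by (simp add: hom_power power_mult_distrib power_mult[symmetric] mult.commute)
  also have "\<dots> = (\<Sum>j<n. \<iota> (c j) * z ^ j) ^ CARD('f)"
    by (rule freshmans_dream_sum'[symmetric, OF char card])
  finally show ?thesis using root by (simp add: zero_power)
qed

lemma CHAR_field_hom:
  fixes \<iota> :: "'f::field \<Rightarrow> 'e::field"
  assumes "field_hom \<iota>"
  shows "CHAR('e) = CHAR('f)"
proof -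
  interpret field_hom \<iota> by fact
  show ?thesis
  proof (rule CHAR_eqI)
    show "of_nat CHAR('f) = (0::'e)"
      by (metis hom_of_nat hom_zero of_nat_CHAR)
    show "CHAR('f) dvd n" if "of_nat n = (0::'e)" for n
      using that by (metis hom_of_nat hom_0_iff of_nat_eq_0_iff_char_dvd)
  qed
qed

text \<open>Coordinates with respect to a two-element basis identify the extension with pairs over
  the base field.\<close>

lemma card_extension_of_degree_2:
  fixes \<iota> :: "'f::{field,finite} \<Rightarrow> 'e::field"
  assumes "is_extension_of_degree 2 \<iota>"
  shows "finite (UNIV :: 'e set)" and "CARD('e) = CARD('f) ^ 2"
proof -
  have "field_hom \<iota>" using assms by (simp add: is_extension_of_degree_def)
  then interpret field_hom \<iota> .
  interpret vs: vector_space "\<lambda>a v. \<iota> a * v"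
    by unfold_locales (auto simp: algebra_simps hom_add hom_mult)
  obtain B where B: "vs.independent B" "vs.span B = UNIV" "card B = 2"
    using assms vs.basis_exists[of UNIV] unfolding is_extension_of_degree_def
    by (metis subset_UNIV subset_antisym)
  obtain b1 b2 where b: "B = {b1, b2}" "b1 \<noteq> b2" using B(3) by (meson card_2_iff)
  define f where "f = (\<lambda>(u, v). \<iota> u * b1 + \<iota> v * b2)"
  have "inj f"
  proof (rule injI)
    fix p p' assume eq: "f p = f p'"
    obtain u v u' v' where p: "p = (u, v)" "p' = (u', v')" by fastforce
    define g where "g t = (if t = b1 then u - u' else v - v')" for t
    have "(\<Sum>t\<in>B. \<iota> (g t) * t) = 0"
      using eq b by (simp add: f_def p g_def hom_minus algebra_simps)
    then have "g t = 0" if "t \<in> B" for t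
      using vs.independentD[OF B(1) _ subset_refl _ that] b by auto
    from this[of b1] this[of b2] show "p = p'" using b by (auto simp: g_def p)
  qed
  have "range f = UNIV"
  proof (intro equalityI subsetI)
    fix t :: 'e
    have "t \<in> vs.span B" using B(2) by simp
    then obtain g where "t = (\<Sum>s\<in>B. \<iota> (g s) * s)"
      using vs.span_finite[of B] b by auto
    then have "t = f (g b1, g b2)" using b by (simp add: f_def)
    then show "t \<in> range f" by blast
  qed simp
  then have bij: "bij f" using \<open>inj f\<close> by (simp add: bij_def)
  show "finite (UNIV :: 'e set)" using \<open>range f = UNIV\<close> finite by (metis finite_imageI)
  show "CARD('e) = CARD('f) ^ 2"
    using bij_betw_same_card[OF bij] by (simp add: power2_eq_square)
qed

subsection \<open>Units of finite rings and of products\<close>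

text \<open>A carrier set is kept so that a quadratic extension can be a proper subset of the
  algebraic closure; elsewhere \<open>S\<close> is \<open>UNIV\<close>.\<close>

definition ring_on :: "'k::field set \<Rightarrow> 'k ring"
  where "ring_on S = \<lparr>carrier = S, monoid.mult = (*), one = 1, ring.zero = 0, ring.add = (+)\<rparr>"

definition finite_subring :: "'k::field set \<Rightarrow> bool"
  where "finite_subring S \<longleftrightarrow> finite S \<and> 0 \<in> S \<and> 1 \<in> S \<and>
    (\<forall>x\<in>S. \<forall>y\<in>S. x + y \<in> S \<and> x * y \<in> S) \<and> (\<forall>x\<in>S. -x \<in> S)"

text \<open>Multiplication by a nonzero element is injective on the finite set \<open>S\<close>,
  hence onto, and so reaches 1. This is how inverses arise from closure under addition, negation and
  multiplication.\<close>

lemma field_ring_on: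
  assumes "finite_subring S"
  shows "Ring.field (ring_on S)"
proof -
  have fin: "finite S" and S: "0 \<in> S" "1 \<in> S"
    and closed: "\<And>x y. x \<in> S \<Longrightarrow> y \<in> S \<Longrightarrow> x + y \<in> S" "\<And>x y. x \<in> S \<Longrightarrow> y \<in> S \<Longrightarrow> x * y \<in> S"
      "\<And>x. x \<in> S \<Longrightarrow> -x \<in> S"
    using assms by (auto simp: finite_subring_def)
  have "cring (ring_on S)"
  proof (intro cringI abelian_groupI comm_monoidI)
    fix x assume "x \<in> carrier (ring_on S)"
    then show "\<exists>y\<in>carrier (ring_on S). y \<oplus>\<^bsub>ring_on S\<^esub> x = \<zero>\<^bsub>ring_on S\<^esub>"
      using closed(3)[of x] by (auto simp: ring_on_def intro!: bexI[of _ "-x"])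
  qed (auto simp: ring_on_def algebra_simps S closed)
  then interpret R: cring "ring_on S" .
  show ?thesis
  proof (rule R.cring_fieldI)
    have "\<exists>y\<in>S. y * x = 1" if "x \<in> S" "x \<noteq> 0" for x
    proof -
      have "inj_on (\<lambda>y. y * x) S" using that by (auto simp: inj_on_def)
      then have "(\<lambda>y. y * x) ` S = S"
        using that closed(2) by (intro endo_inj_surj fin) auto
      then show ?thesis using S(2) by (metis imageE)
    qed
    moreover have "0 \<notin> Units (ring_on S)" by (auto simp: Units_def ring_on_def)
    ultimately show "Units (ring_on S) = carrier (ring_on S) - {\<zero>\<^bsub>ring_on S\<^esub>}"
      by (auto simp: Units_def ring_on_def mult.commute)
  qed
qed

text \<open>The map i -> g^i factors through residues because g^n = 1; it is onto by
  \<open>gen\<close>, and injective since both sides have n elements.\<close>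

lemma cyclic_iso_integer_mod_group:
  assumes "group G" and fin: "finite (carrier G)" and g: "g \<in> carrier G"
    and gen: "carrier G = {g [^]\<^bsub>G\<^esub> (i::nat) | i. True}"
  shows "integer_mod_group (Coset.order G) \<cong> G"
proof -
  interpret group G by fact
  let ?n = "Coset.order G" and ?f = "\<lambda>x::int. g [^]\<^bsub>G\<^esub> x"
  have n: "?n > 0" by (simp add: fin order_gt_0_iff_finite)
  have gn: "g [^]\<^bsub>G\<^esub> (int ?n) = \<one>\<^bsub>G\<^esub>"
    by (simp add: int_pow_int pow_order_eq_1 g)
  have modn: "g [^]\<^bsub>G\<^esub> (x mod int ?n) = g [^]\<^bsub>G\<^esub> x" for x :: int
  proof -
    have "g [^]\<^bsub>G\<^esub> x = g [^]\<^bsub>G\<^esub> (int ?n * (x div int ?n) + x mod int ?n)" by simp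
    also have "\<dots> = (g [^]\<^bsub>G\<^esub> (int ?n)) [^]\<^bsub>G\<^esub> (x div int ?n) \<otimes>\<^bsub>G\<^esub> g [^]\<^bsub>G\<^esub> (x mod int ?n)"
      by (simp add: g int_pow_pow flip: int_pow_mult)
    finally show ?thesis by (simp add: gn g)
  qed
  have "?f ` {0..<int ?n} = carrier G"
  proof (intro equalityI subsetI)
    fix h assume "h \<in> carrier G"
    then obtain i :: nat where "h = g [^]\<^bsub>G\<^esub> i" using gen by blast
    then have "h = ?f (int i mod int ?n)" by (simp add: modn int_pow_int)
    then show "h \<in> ?f ` {0..<int ?n}" using n by (intro image_eqI) auto
  qed (auto simp: g)
  moreover from this have "inj_on ?f {0..<int ?n}"
    by (intro eq_card_imp_inj_on) (auto simp: Coset.order_def)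
  ultimately have "?f \<in> iso (integer_mod_group ?n) G"
    using n by (auto simp: iso_def bij_betw_def hom_def carrier_integer_mod_group modn g int_pow_mult)
  then show ?thesis by (rule is_isoI)
qed

lemma units_ring_on_iso:
  assumes S: "finite_subring S"
  shows "units_of (ring_on S) \<cong> integer_mod_group (card S - 1)"
proof -
  interpret R: Ring.field "ring_on S" by (rule field_ring_on[OF S])
  let ?M = "Multiplicative_Group.mult_of (ring_on S)"
  have fin': "finite (carrier (ring_on S))" using S by (simp add: ring_on_def finite_subring_def)
  obtain g where g: "g \<in> carrier ?M" "carrier ?M = {g [^]\<^bsub>ring_on S\<^esub> i | i::nat. i \<in> UNIV}"
    using R.finite_field_mult_group_has_gen[OF fin'] by (rule bexE)
  have "Coset.order ?M = card S - 1" using R.order_mult_of[OF fin'] by (simp add: Coset.order_def ring_on_def)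
  moreover have "carrier ?M = {g [^]\<^bsub>?M\<^esub> (i::nat) | i. True}"
    using g(2) by (simp only: Multiplicative_Group.nat_pow_mult_of UNIV_I)
  ultimately have "integer_mod_group (card S - 1) \<cong> ?M"
    using cyclic_iso_integer_mod_group[OF R.field_mult_group R.finite_mult_of[OF fin'] g(1)] by metis
  then show ?thesis using R.mult_of_is_Units by (metis group.iso_sym group_integer_mod_group)
qed

section \<open>Unit groups of products and their transport along bijections\<close>

lemma units_of_DirProd:
  "units_of (A \<times>\<times> B) = units_of A \<times>\<times> units_of B"
proof -
  have "Units (A \<times>\<times> B) = Units A \<times> Units B"
    by (fastforce simp: Units_def DirProd_def)
  then show ?thesis by (simp add: units_of_def DirProd_def)
qed

lemma units_of_group_power:
  "units_of (group_power R m) = group_power (units_of R) m"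
proof -
  have "Units (group_power R m) = (\<Pi>\<^sub>E i\<in>{..<m}. Units R)"
  proof (intro equalityI subsetI)
    fix u assume "u \<in> Units (group_power R m)"
    then obtain v where uv: "u \<in> (\<Pi>\<^sub>E i\<in>{..<m}. carrier R)" "v \<in> (\<Pi>\<^sub>E i\<in>{..<m}. carrier R)"
      "(\<lambda>i\<in>{..<m}. v i \<otimes>\<^bsub>R\<^esub> u i) = (\<lambda>i\<in>{..<m}. \<one>\<^bsub>R\<^esub>)" "(\<lambda>i\<in>{..<m}. u i \<otimes>\<^bsub>R\<^esub> v i) = (\<lambda>i\<in>{..<m}. \<one>\<^bsub>R\<^esub>)"
      by (auto simp: Units_def group_power_def)
    have "u i \<in> Units R" if "i < m" for i
      using uv(1,2) fun_cong[OF uv(3), of i] fun_cong[OF uv(4), of i] that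
      by (auto simp: Units_def PiE_iff intro!: bexI[of _ "v i"])
    then show "u \<in> (\<Pi>\<^sub>E i\<in>{..<m}. Units R)" using uv(1) by (auto simp: PiE_iff)
  next
    fix u assume u: "u \<in> (\<Pi>\<^sub>E i\<in>{..<m}. Units R)"
    then have "\<forall>i\<in>{..<m}. \<exists>v\<in>carrier R. v \<otimes>\<^bsub>R\<^esub> u i = \<one>\<^bsub>R\<^esub> \<and> u i \<otimes>\<^bsub>R\<^esub> v = \<one>\<^bsub>R\<^esub>"
      by (auto simp: Units_def PiE_iff)
    then obtain v where v: "\<forall>i\<in>{..<m}. v i \<in> carrier R \<and> v i \<otimes>\<^bsub>R\<^esub> u i = \<one>\<^bsub>R\<^esub> \<and> u i \<otimes>\<^bsub>R\<^esub> v i = \<one>\<^bsub>R\<^esub>"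
      by metis
    have "restrict v {..<m} \<in> (\<Pi>\<^sub>E i\<in>{..<m}. carrier R)" using v by auto
    moreover have "u \<in> (\<Pi>\<^sub>E i\<in>{..<m}. carrier R)" using u by (auto simp: Units_def PiE_iff)
    ultimately show "u \<in> Units (group_power R m)"
      unfolding Units_def group_power_def
      using v by (auto simp: fun_eq_iff intro!: bexI[of _ "restrict v {..<m}"])
  qed
  then show ?thesis by (simp add: units_of_def group_power_def product_group_def)
qed

text \<open>The condition on the unit is explicit because \<open>hom\<close> only asks for
  multiplicativity, and between monoids such a map may move 1. Addition is absent, as only groups of
  units are compared.\<close>

definition unital_hom :: "('a, 'm) monoid_scheme \<Rightarrow> ('b, 'n) monoid_scheme \<Rightarrow> ('a \<Rightarrow> 'b) set"
  where "unital_hom A B = {f \<in> hom A B. f \<one>\<^bsub>A\<^esub> = \<one>\<^bsub>B\<^esub>}"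

lemma unital_hom_DirProd:
  assumes "f \<in> unital_hom A B" "g \<in> unital_hom A C"
  shows "(\<lambda>a. (f a, g a)) \<in> unital_hom A (B \<times>\<times> C)"
  using assms by (auto simp: unital_hom_def hom_def)

lemma unital_hom_group_power:
  assumes "\<And>i. i < m \<Longrightarrow> f i \<in> unital_hom A R"
  shows "(\<lambda>a. \<lambda>i\<in>{..<m}. f i a) \<in> unital_hom A (group_power R m)"
  using assms by (fastforce simp: unital_hom_def hom_def group_power_def Pi_iff fun_eq_iff)

text \<open>An inverse of \<open>f u\<close> has the form \<open>f w\<close>, and injectivity pulls
  both equations back. The closure facts are stated by hand since the group algebra is handled as a
  bare structure, without a proof that it is a ring.\<close>

lemma units_of_iso_if_bij:
  assumes closed: "\<one>\<^bsub>A\<^esub> \<in> carrier A" "\<And>u v. u \<in> carrier A \<Longrightarrow> v \<in> carrier A \<Longrightarrow> u \<otimes>\<^bsub>A\<^esub> v \<in> carrier A"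
    and f: "f \<in> unital_hom A B" and bij: "bij_betw f (carrier A) (carrier B)"
  shows "units_of A \<cong> units_of B"
proof -
  have hom: "f (u \<otimes>\<^bsub>A\<^esub> v) = f u \<otimes>\<^bsub>B\<^esub> f v" if "u \<in> carrier A" "v \<in> carrier A" for u v
    using f that by (simp add: unital_hom_def hom_def)
  have one: "f \<one>\<^bsub>A\<^esub> = \<one>\<^bsub>B\<^esub>" using f by (simp add: unital_hom_def)
  have inj: "f u = f v \<longleftrightarrow> u = v" if "u \<in> carrier A" "v \<in> carrier A" for u v
    using bij that by (auto simp: bij_betw_def inj_on_def)
  have surj: "f ` carrier A = carrier B" using bij by (simp add: bij_betw_def)
  have unit_iff: "f u \<in> Units B \<longleftrightarrow> u \<in> Units A" if u: "u \<in> carrier A" for u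
  proof -
    have "f u \<in> Units B \<longleftrightarrow> (\<exists>w\<in>f ` carrier A. w \<otimes>\<^bsub>B\<^esub> f u = f \<one>\<^bsub>A\<^esub> \<and> f u \<otimes>\<^bsub>B\<^esub> w = f \<one>\<^bsub>A\<^esub>)"
      using u surj one by (auto simp: Units_def)
    also have "\<dots> \<longleftrightarrow> u \<in> Units A"
      using u by (auto simp: Units_def inj closed simp flip: hom)
    finally show ?thesis .
  qed
  have "bij_betw f (Units A) (Units B)"
    unfolding bij_betw_def
  proof
    show "inj_on f (Units A)" by (auto simp: inj_on_def inj Units_def)
    show "f ` Units A = Units B"
    proof (intro equalityI subsetI)
      fix w assume w: "w \<in> Units B"
      then have "w \<in> f ` carrier A" using surj by (simp add: Units_def)
      then obtain u where "u \<in> carrier A" "w = f u" by blast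
      with w unit_iff show "w \<in> f ` Units A" by blast
    qed (use unit_iff in \<open>auto simp: Units_def\<close>)
  qed
  then have "f \<in> iso (units_of A) (units_of B)"
    using bij_betwE[of f "Units A" "Units B"]
    by (auto simp: iso_def units_of_def Units_def hom intro!: homI)
  then show ?thesis by (rule is_isoI)
qed

lemma group_power_iso:
  assumes "group H" "group K" "H \<cong> K"
  shows "group_power H m \<cong> group_power K m"
  unfolding group_power_def using assms by (intro iso_product_groupI) auto

lemma group_group_power: "group H \<Longrightarrow> group (group_power H m)"
  by (simp add: group_power_def)

lemma units_group_power_ring_on_iso:
  assumes "finite_subring S"
  shows "group (units_of (group_power (ring_on S) m))"
    and "units_of (group_power (ring_on S) m) \<cong> group_power (integer_mod_group (card S - 1)) m"
proof -
  interpret R: Ring.field "ring_on S" by (rule field_ring_on[OF assms])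
  show "group (units_of (group_power (ring_on S) m))"
    unfolding units_of_group_power by (rule group_group_power[OF R.units_group])
  show "units_of (group_power (ring_on S) m) \<cong> group_power (integer_mod_group (card S - 1)) m"
    unfolding units_of_group_power
    by (rule group_power_iso[OF R.units_group group_integer_mod_group units_ring_on_iso[OF assms]])
qed

lemma units_group_power_ring_mat:
  "units_of (group_power (ring_mat TYPE('k::field) n ()) m) = group_power (general_linear_group n TYPE('k)) m"
  by (simp add: units_of_group_power general_linear_group_def)

lemma card_group_power:
  assumes "finite (carrier R)"
  shows "finite (carrier (group_power R m))" and "card (carrier (group_power R m)) = card (carrier R) ^ m"
  using assms by (simp_all add: group_power_def card_PiE finite_PiE)

text \<open>An upper bound is enough: the opposite inequality comes from injectivity on the group
  algebra.\<close>

lemma finite_carrier_mat_2_2: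
  assumes fin: "finite (UNIV :: 'k set)"
  shows "finite (carrier_mat 2 2 :: 'k mat set)" and "card (carrier_mat 2 2 :: 'k mat set) \<le> CARD('k) ^ 4"
proof -
  define f :: "'k \<times> 'k \<times> 'k \<times> 'k \<Rightarrow> 'k mat"
    where "f = (\<lambda>(a, b, c, d). mat 2 2 (\<lambda>(i, j). if i = 0 then if j = 0 then a else b else if j = 0 then c else d))"
  have sub: "carrier_mat 2 2 \<subseteq> range f"
  proof
    fix M :: "'k mat" assume M: "M \<in> carrier_mat 2 2"
    have "M = f (M $$ (0,0), M $$ (0,1), M $$ (1,0), M $$ (1,1))"
      using M by (intro eq_matI) (auto simp: f_def less_2_cases_iff)
    then show "M \<in> range f" by blast
  qed
  have fin4: "finite (UNIV :: ('k \<times> 'k \<times> 'k \<times> 'k) set)"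
    using fin by (simp add: finite_prod)
  then have finr: "finite (range f)" by simp
  show "finite (carrier_mat 2 2 :: 'k mat set)" using finite_subset[OF sub finr] .
  have "card (carrier_mat 2 2 :: 'k mat set) \<le> card (range f)" by (rule card_mono[OF finr sub])
  also have "\<dots> \<le> card (UNIV :: ('k \<times> 'k \<times> 'k \<times> 'k) set)" by (rule card_image_le[OF fin4])
  also have "\<dots> = CARD('k) ^ 4" by (simp add: numeral_eq_Suc algebra_simps)
  finally show "card (carrier_mat 2 2 :: 'k mat set) \<le> CARD('k) ^ 4" .
qed

subsection \<open>Normal form of the elements of the group\<close>

definition exponents :: "(nat \<times> nat) set"
  where "exponents = {..<3} \<times> {..<8}"

text \<open>Since \<open>y x = x\<^sup>2 y\<close>, the product of \<open>x\<^sup>i y\<^sup>j\<close> and \<open>x\<^sup>k y\<^sup>l\<close> is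
  \<open>x\<^sup>m y\<^sup>n\<close> with \<open>m = i + 2\<^sup>j k\<close> and \<open>n = j + l\<close>.\<close>

definition exponents_mult :: "nat \<times> nat \<Rightarrow> nat \<times> nat \<Rightarrow> nat \<times> nat"
  where "exponents_mult p r = ((fst p + 2 ^ snd p * fst r) mod 3, (snd p + snd r) mod 8)"

text \<open>Stated for any monoid, so that the same normal form is computed in the group and among 2
  x 2 matrices.\<close>

definition word :: "('a, 'm) monoid_scheme \<Rightarrow> 'a \<Rightarrow> 'a \<Rightarrow> nat \<times> nat \<Rightarrow> 'a"
  where "word M u v p = (u [^]\<^bsub>M\<^esub> (fst p)) \<otimes>\<^bsub>M\<^esub> (v [^]\<^bsub>M\<^esub> (snd p))"

lemma finite_exponents [simp]: "finite exponents"
  by (simp add: exponents_def)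

lemma exponents_mult_in: "exponents_mult p r \<in> exponents"
  by (simp add: exponents_def exponents_mult_def)

lemma (in monoid) pow_mod_exponent:
  assumes "u \<in> carrier G" "u [^] (n::nat) = \<one>"
  shows "u [^] (m mod n) = u [^] m"
proof -
  have "u [^] m = u [^] (n * (m div n) + m mod n)" by simp
  also have "\<dots> = (u [^] n) [^] (m div n) \<otimes> u [^] (m mod n)"
    by (simp only: nat_pow_mult nat_pow_pow assms(1))
  finally show ?thesis using assms by simp
qed

lemma (in monoid) word_closed: "u \<in> carrier G \<Longrightarrow> v \<in> carrier G \<Longrightarrow> word G u v p \<in> carrier G"
  by (simp add: word_def)

text \<open>Moving v past a power of u doubles its exponent, so moving v^j past it multiplies the
  exponent by 2^j. Writing the relation with u^2 in place of the inverse of u lets it make sense for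
  matrices too.\<close>

lemma (in monoid) word_mult:
  assumes u: "u \<in> carrier G" "u [^] (3::nat) = \<one>" and v: "v \<in> carrier G" "v [^] (8::nat) = \<one>"
    and vu: "v \<otimes> u = u [^] (2::nat) \<otimes> v"
  shows "word G u v p \<otimes> word G u v r = word G u v (exponents_mult p r)"
proof -
  note [simp] = u(1) v(1)
  have 1: "v \<otimes> u [^] i = u [^] (2 * i) \<otimes> v" for i :: nat
  proof (induction i)
    case (Suc i)
    have "v \<otimes> u [^] Suc i = (v \<otimes> u [^] i) \<otimes> u" by (simp add: m_assoc)
    also have "\<dots> = u [^] (2 * i) \<otimes> (v \<otimes> u)" by (simp add: Suc m_assoc)
    also have "\<dots> = (u [^] (2 * i) \<otimes> u [^] (2::nat)) \<otimes> v" by (simp only: vu m_assoc nat_pow_closed u(1) v(1))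
    also have "\<dots> = u [^] (2 * Suc i) \<otimes> v" by (simp add: nat_pow_mult)
    finally show ?case .
  qed simp
  have 2: "v [^] j \<otimes> u [^] i = u [^] (2 ^ j * i) \<otimes> v [^] j" for i j :: nat
  proof (induction j arbitrary: i)
    case (Suc j)
    have "v [^] Suc j \<otimes> u [^] i = v [^] j \<otimes> (v \<otimes> u [^] i)" by (simp add: m_assoc)
    also have "\<dots> = (v [^] j \<otimes> u [^] (2 * i)) \<otimes> v" by (simp add: 1 m_assoc)
    also have "\<dots> = u [^] (2 ^ Suc j * i) \<otimes> v [^] Suc j" by (simp add: Suc m_assoc mult_ac)
    finally show ?case .
  qed simp
  obtain i j i' j' where p: "p = (i, j)" "r = (i', j')" by fastforce
  have "word G u v p \<otimes> word G u v r = u [^] i \<otimes> (v [^] j \<otimes> u [^] i') \<otimes> v [^] j'"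
    by (simp add: word_def p m_assoc)
  also have "\<dots> = (u [^] i \<otimes> u [^] (2 ^ j * i')) \<otimes> (v [^] j \<otimes> v [^] j')"
    by (simp add: 2 m_assoc)
  also have "\<dots> = u [^] (i + 2 ^ j * i') \<otimes> v [^] (j + j')"
    by (simp only: nat_pow_mult u(1) v(1))
  also have "\<dots> = word G u v (exponents_mult p r)"
    by (simp add: word_def p exponents_mult_def pow_mod_exponent u v)
  finally show ?thesis .
qed

locale C3_rtimes_C8 = group G for G (structure) +
  fixes x y
  assumes x_in [simp]: "x \<in> carrier G" and y_in [simp]: "y \<in> carrier G"
    and generate_xy: "generate G {x, y} = carrier G"
    and x_pow: "x [^] (3::nat) = \<one>" and y_pow: "y [^] (8::nat) = \<one>"
    and conj: "y \<otimes> x \<otimes> inv y = inv x"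
    and order_24: "Coset.order G = 24"
begin

abbreviation elem :: "nat \<times> nat \<Rightarrow> 'a" where "elem \<equiv> word G x y"

lemma inv_x: "inv x = x [^] (2::nat)"
  by (rule inv_equality) (use x_pow in \<open>simp_all add: numeral_eq_Suc m_assoc\<close>)

lemma inv_y: "inv y = y [^] (7::nat)"
  by (rule inv_equality) (use y_pow in \<open>simp_all add: numeral_eq_Suc m_assoc\<close>)

lemma yx: "y \<otimes> x = x [^] (2::nat) \<otimes> y"
proof -
  have "y \<otimes> x = (y \<otimes> x \<otimes> inv y) \<otimes> y" by (simp add: m_assoc)
  then show ?thesis by (simp only: conj inv_x)
qed

lemma elem_mult: "elem p \<otimes> elem r = elem (exponents_mult p r)"
  by (rule word_mult) (simp_all add: x_pow y_pow yx)

lemma elem_0: "elem (0, 0) = \<one>"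
  by (simp add: word_def)

text \<open>Words are closed under products and contain the generators and their inverses, so they
  exhaust the group. There are 3 * 8 = 24 exponent pairs, so the order 24 forces distinct words to
  be distinct elements.\<close>

lemma bij_elem: "bij_betw elem exponents (carrier G)"
proof -
  have "carrier G \<subseteq> elem ` exponents"
  proof
    fix g assume "g \<in> carrier G"
    then have "g \<in> generate G {x, y}" by (simp add: generate_xy)
    then show "g \<in> elem ` exponents"
    proof induction
      case one
      show ?case by (rule image_eqI[of _ _ "(0, 0)"]) (simp_all add: elem_0 exponents_def)
    next
      case (incl h)
      have "x = elem (1, 0)" "y = elem (0, 1)" by (simp_all add: word_def)
      moreover have "(1, 0) \<in> exponents" "(0, 1) \<in> exponents" by (simp_all add: exponents_def)
      ultimately show ?case using incl by blast
    next
      case (inv h)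
      have "inv x = elem (2, 0)" "inv y = elem (0, 7)"
        by (simp_all add: word_def inv_x inv_y)
      moreover have "(2, 0) \<in> exponents" "(0, 7) \<in> exponents" by (simp_all add: exponents_def)
      ultimately show ?case using inv by blast
    next
      case (eng h1 h2)
      then obtain p r where "h1 = elem p" "h2 = elem r" by blast
      then show ?case by (simp add: elem_mult exponents_mult_in)
    qed
  qed
  moreover have "elem ` exponents \<subseteq> carrier G" by (auto simp: word_closed)
  ultimately have img: "elem ` exponents = carrier G" by blast
  moreover have "inj_on elem exponents"
    by (rule eq_card_imp_inj_on) (use order_24 img in \<open>auto simp: Coset.order_def exponents_def\<close>)
  ultimately show ?thesis by (simp add: bij_betw_def)
qed

lemma elem_inj: "p \<in> exponents \<Longrightarrow> r \<in> exponents \<Longrightarrow> elem p = elem r \<longleftrightarrow> p = r"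
  using bij_elem by (auto simp: bij_betw_def inj_on_def)

lemma elem_surj:
  assumes "g \<in> carrier G"
  obtains p where "p \<in> exponents" "g = elem p"
proof -
  have "g \<in> elem ` exponents" using assms bij_elem by (simp add: bij_betw_def)
  then show ?thesis using that by blast
qed

end

text \<open>The linear extension of a function on normal forms. The map \<kappa> is the identity for
  representations over F and the embedding for those over an extension; \<open>f\<close> will be a
  character or a matrix entry.\<close>

definition lin_eval :: "('f \<Rightarrow> 'k) \<Rightarrow> (nat \<times> nat \<Rightarrow> 'k) \<Rightarrow> (nat \<times> nat \<Rightarrow> 'f) \<Rightarrow> 'k::field"
  where "lin_eval \<kappa> f a = (\<Sum>p\<in>exponents. \<kappa> (a p) * f p)"

section \<open>Convolution in normal form coordinates and the counting argument\<close>

context C3_rtimes_C8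
begin

lemma group_algebra_mult_elem:
  assumes "s \<in> exponents"
  shows "(a \<otimes>\<^bsub>group_algebra F G\<^esub> b) (elem s) =
    (\<Sum>pr | pr \<in> exponents \<times> exponents \<and> exponents_mult (fst pr) (snd pr) = s.
       a (elem (fst pr)) * b (elem (snd pr)))"
proof -
  let ?P = "{pr \<in> exponents \<times> exponents. exponents_mult (fst pr) (snd pr) = s}"
  let ?Q = "{(g, h). g \<in> carrier G \<and> h \<in> carrier G \<and> g \<otimes> h = elem s}"
  have "bij_betw (map_prod elem elem) (exponents \<times> exponents) (carrier G \<times> carrier G)"
    using bij_elem by (rule bij_betw_map_prod[OF _ bij_elem])
  moreover have "?P \<subseteq> exponents \<times> exponents" by blast
  moreover have "map_prod elem elem ` ?P = ?Q"
  proof (intro equalityI subsetI)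
    fix gh assume "gh \<in> ?Q"
    then obtain g h where gh: "gh = (g, h)" "g \<in> carrier G" "h \<in> carrier G" "g \<otimes> h = elem s" by blast
    then obtain p r where pr: "p \<in> exponents" "g = elem p" "r \<in> exponents" "h = elem r"
      using elem_surj by metis
    with gh have "exponents_mult p r = s"
      by (simp add: elem_mult elem_inj exponents_mult_in assms)
    with pr gh show "gh \<in> map_prod elem elem ` ?P" by (force intro!: image_eqI[of _ _ "(p, r)"])
  qed (auto simp: elem_mult word_closed)
  ultimately have "bij_betw (map_prod elem elem) ?P ?Q"
    by (metis (no_types, lifting) bij_betw_subset)
  from sum.reindex_bij_betw[OF this, of "\<lambda>(g, h). a g * b h"]
  show ?thesis by (simp add: group_algebra_def case_prod_unfold mem_Times_iff)
qed

text \<open>Summing the convolution over all values \<open>s\<close> removes the constraint on the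
  pair, since every pair of exponents has exactly one product. What remains is how \<open>f\<close>
  behaves under \<open>exponents_mult\<close>.\<close>

lemma lin_eval_mult:
  assumes "field_hom \<kappa>"
  shows "lin_eval \<kappa> f ((a \<otimes>\<^bsub>group_algebra F G\<^esub> b) \<circ> elem) =
    (\<Sum>p\<in>exponents. \<Sum>r\<in>exponents. \<kappa> (a (elem p)) * \<kappa> (b (elem r)) * f (exponents_mult p r))"
proof -
  interpret field_hom \<kappa> by fact
  let ?E = "exponents \<times> exponents"
  have "lin_eval \<kappa> f ((a \<otimes>\<^bsub>group_algebra F G\<^esub> b) \<circ> elem) =
    (\<Sum>s\<in>exponents. \<Sum>pr | pr \<in> ?E \<and> exponents_mult (fst pr) (snd pr) = s.
       \<kappa> (a (elem (fst pr))) * \<kappa> (b (elem (snd pr))) * f (exponents_mult (fst pr) (snd pr)))"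
    unfolding lin_eval_def
    by (rule sum.cong) (auto simp: group_algebra_mult_elem case_prod_unfold hom_sum hom_mult sum_distrib_right
        intro!: sum.cong)
  also have "\<dots> = (\<Sum>pr\<in>?E. \<kappa> (a (elem (fst pr))) * \<kappa> (b (elem (snd pr))) * f (exponents_mult (fst pr) (snd pr)))"
    by (rule sum.group) (auto simp: exponents_mult_in)
  also have "\<dots> = (\<Sum>p\<in>exponents. \<Sum>r\<in>exponents. \<kappa> (a (elem p)) * \<kappa> (b (elem r)) * f (exponents_mult p r))"
    by (simp add: sum.cartesian_product case_prod_unfold)
  finally show ?thesis .
qed

lemma lin_eval_one:
  assumes "field_hom \<kappa>"
  shows "lin_eval \<kappa> f (\<one>\<^bsub>group_algebra F G\<^esub> \<circ> elem) = f (0, 0)"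
proof -
  interpret field_hom \<kappa> by fact
  have 0: "(0, 0) \<in> exponents" by (simp add: exponents_def)
  have "lin_eval \<kappa> f (\<one>\<^bsub>group_algebra F G\<^esub> \<circ> elem) = (\<Sum>p\<in>exponents. if p = (0, 0) then f p else 0)"
    unfolding lin_eval_def
    by (rule sum.cong) (auto simp: group_algebra_def elem_inj[OF _ 0] simp flip: elem_0)
  then show ?thesis using 0 by simp
qed

lemma group_algebra_one_closed: "\<one>\<^bsub>group_algebra F G\<^esub> \<in> carrier (group_algebra F G)"
  by (auto simp: group_algebra_def)

lemma group_algebra_mult_closed:
  "a \<otimes>\<^bsub>group_algebra F G\<^esub> b \<in> carrier (group_algebra F G)"
  by (auto simp: group_algebra_def intro!: sum.neutral)

lemma card_group_algebra:
  "finite (carrier (group_algebra TYPE('f::{field,finite}) G))"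
  "card (carrier (group_algebra TYPE('f::{field,finite}) G)) = CARD('f) ^ 24"
proof -
  let ?A = "carrier (group_algebra TYPE('f) G)" and ?P = "\<Pi>\<^sub>E g\<in>carrier G. (UNIV :: 'f set)"
  have finG: "finite (carrier G)" using bij_elem bij_betw_finite finite_exponents by blast
  have bij: "bij_betw (\<lambda>a. restrict a (carrier G)) ?A ?P"
    by (rule bij_betwI[where g = "\<lambda>a g. if g \<in> carrier G then a g else 0"])
      (auto simp: group_algebra_def fun_eq_iff PiE_iff extensional_def)
  show "finite ?A" using bij_betw_finite[OF bij] finG by (simp add: finite_PiE)
  show "card ?A = CARD('f) ^ 24"
    using bij_betw_same_card[OF bij] order_24 finG by (simp add: card_PiE Coset.order_def)
qed

text \<open>Each case is reduced to two checks: the coefficients are determined by the image, and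
  the target has at most q^24 elements.\<close>

lemma units_group_algebra_iso:
  fixes B :: "('c, 'd) monoid_scheme"
  assumes f: "f \<in> unital_hom (group_algebra TYPE('f::{field,finite}) G) B"
    and inj: "\<And>a b p. a \<in> carrier (group_algebra TYPE('f) G) \<Longrightarrow> b \<in> carrier (group_algebra TYPE('f) G) \<Longrightarrow>
      f a = f b \<Longrightarrow> p \<in> exponents \<Longrightarrow> a (elem p) = b (elem p)"
    and B: "finite (carrier B)" "card (carrier B) \<le> CARD('f) ^ 24"
  shows "units_of (group_algebra TYPE('f) G) \<cong> units_of B"
proof (rule units_of_iso_if_bij[OF _ _ f])
  let ?A = "carrier (group_algebra TYPE('f) G)"
  have "inj_on f ?A"
  proof (rule inj_onI)
    fix a b assume ab: "a \<in> ?A" "b \<in> ?A" and "f a = f b"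
    then have eq: "a (elem p) = b (elem p)" if "p \<in> exponents" for p using inj that by blast
    have "a g = b g" for g
    proof (cases "g \<in> carrier G")
      case True
      then obtain p where "p \<in> exponents" "g = elem p" by (rule elem_surj)
      then show ?thesis using eq by simp
    qed (use ab in \<open>simp add: group_algebra_def\<close>)
    then show "a = b" by blast
  qed
  moreover have "f ` ?A = carrier B"
  proof (rule card_subset_eq[OF B(1)])
    show sub: "f ` ?A \<subseteq> carrier B" using f by (auto simp: unital_hom_def hom_def)
    show "card (f ` ?A) = card (carrier B)"
      using card_image[OF \<open>inj_on f ?A\<close>] card_mono[OF B(1) sub] B(2)
      by (simp add: card_group_algebra)
  qed
  ultimately show "bij_betw f ?A (carrier B)" by (simp add: bij_betw_def)
qed (simp_all add: group_algebra_one_closed group_algebra_mult_closed)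

end

subsection \<open>Characters and two-dimensional representations\<close>

context C3_rtimes_C8
begin

text \<open>The set \<open>S\<close> is separate from the type of \<open>z\<close> for the case in
  which the values lie in a finite subfield of the algebraic closure.\<close>

lemma character_hom:
  assumes \<kappa>: "field_hom (\<kappa> :: 'f \<Rightarrow> 'k::field)" and z: "z ^ 8 = (1::'k)"
    and S: "\<And>a. lin_eval \<kappa> (\<lambda>p. z ^ snd p) a \<in> S"
  shows "(\<lambda>a. lin_eval \<kappa> (\<lambda>p. z ^ snd p) (a \<circ> elem)) \<in> unital_hom (group_algebra TYPE('f::field) G) (ring_on S)"
proof -
  have "z ^ (m mod 8) = z ^ m" for m
  proof -
    have "z ^ m = z ^ (8 * (m div 8) + m mod 8)" by simp
    then show ?thesis using z by (simp only: power_add power_mult power_one mult_1)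
  qed
  then have z_mult: "z ^ snd (exponents_mult p r) = z ^ snd p * z ^ snd r" for p r
    by (simp add: exponents_mult_def power_add)
  let ?c = "lin_eval \<kappa> (\<lambda>p. z ^ snd p)"
  have "?c ((a \<otimes>\<^bsub>group_algebra TYPE('f) G\<^esub> b) \<circ> elem) = ?c (a \<circ> elem) * ?c (b \<circ> elem)" for a b
    by (simp add: lin_eval_mult[OF \<kappa>] z_mult) (simp add: lin_eval_def sum_product mult_ac)
  moreover have "?c (\<one>\<^bsub>group_algebra TYPE('f) G\<^esub> \<circ> elem) = 1"
    by (simp add: lin_eval_one[OF \<kappa>])
  ultimately show ?thesis
    unfolding unital_hom_def ring_on_def using S by (auto intro!: homI)
qed

text \<open>By \<open>word_mult\<close>, matrices subject to the relations multiply as the group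
  elements do; reordering the sums turns the convolution into a product of rows and columns.\<close>

lemma representation_hom:
  assumes \<kappa>: "field_hom (\<kappa> :: 'f \<Rightarrow> 'k::field)"
    and u: "u \<in> carrier_mat 2 2" "u [^]\<^bsub>ring_mat TYPE('k) 2 ()\<^esub> (3::nat) = 1\<^sub>m 2"
    and v: "v \<in> carrier_mat 2 2" "v [^]\<^bsub>ring_mat TYPE('k) 2 ()\<^esub> (8::nat) = 1\<^sub>m 2"
    and vu: "v * u = u [^]\<^bsub>ring_mat TYPE('k) 2 ()\<^esub> (2::nat) * v"
  shows "(\<lambda>a. mat 2 2 (\<lambda>ij. lin_eval \<kappa> (\<lambda>p. word (ring_mat TYPE('k) 2 ()) u v p $$ ij) (a \<circ> elem)))
    \<in> unital_hom (group_algebra TYPE('f::field) G) (ring_mat TYPE('k) 2 ())"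
    (is "(\<lambda>a. mat 2 2 (?r a)) \<in> _")
proof -
  let ?M = "ring_mat TYPE('k) 2 ()"
  interpret M: Ring.ring ?M by (rule ring_mat)
  let ?W = "word ?M u v"
  have W: "?W p \<in> carrier_mat 2 2" for p
    using M.word_closed[of u v p] u v by (simp add: ring_mat_simps)
  have W_mult: "?W (exponents_mult p r) = ?W p * ?W r" for p r
    using M.word_mult[of u v p r] u v vu by (simp add: ring_mat_simps)
  have entry: "?W (exponents_mult p r) $$ (i, j) = (\<Sum>l<2. ?W p $$ (i, l) * ?W r $$ (l, j))"
    if "i < 2" "j < 2" for p r i j
    using that W[of p] W[of r] by (simp add: W_mult scalar_prod_def lessThan_atLeast0)
  have "mat 2 2 (?r (a \<otimes>\<^bsub>group_algebra TYPE('f) G\<^esub> b)) = mat 2 2 (?r a) * mat 2 2 (?r b)" for a b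
  proof (rule eq_matI)
    fix i j assume "i < dim_row (mat 2 2 (?r a) * mat 2 2 (?r b))" "j < dim_col (mat 2 2 (?r a) * mat 2 2 (?r b))"
    then have ij: "i < 2" "j < 2" by auto
    have "?r (a \<otimes>\<^bsub>group_algebra TYPE('f) G\<^esub> b) (i, j) =
      (\<Sum>p\<in>exponents. \<Sum>r\<in>exponents. \<Sum>l<2. (\<kappa> (a (elem p)) * ?W p $$ (i, l)) * (\<kappa> (b (elem r)) * ?W r $$ (l, j)))"
      by (simp add: lin_eval_mult[OF \<kappa>] entry[OF ij] sum_distrib_left mult_ac)
    also have "\<dots> = (\<Sum>l<2. \<Sum>p\<in>exponents. \<Sum>r\<in>exponents.
        (\<kappa> (a (elem p)) * ?W p $$ (i, l)) * (\<kappa> (b (elem r)) * ?W r $$ (l, j)))"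
      \<comment> \<open>The index \<open>l\<close> of the matrix product moves outwards past
        \<open>p\<close> and \<open>r\<close>, one swap for each.\<close>
      by (subst sum.swap) (intro sum.cong refl sum.swap)
    also have "\<dots> = (\<Sum>l<2. ?r a (i, l) * ?r b (l, j))"
      by (simp add: lin_eval_def sum_product)
    finally show "mat 2 2 (?r (a \<otimes>\<^bsub>group_algebra TYPE('f) G\<^esub> b)) $$ (i, j) = (mat 2 2 (?r a) * mat 2 2 (?r b)) $$ (i, j)"
      using ij by (simp add: scalar_prod_def lessThan_atLeast0)
  qed auto
  moreover have "mat 2 2 (?r \<one>\<^bsub>group_algebra TYPE('f) G\<^esub>) = 1\<^sub>m 2"
  proof -
    have "?W (0, 0) = 1\<^sub>m 2"
      using M.l_one[OF M.one_closed] by (simp add: word_def ring_mat_simps)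
    then show ?thesis by (intro eq_matI) (auto simp: lin_eval_one[OF \<kappa>])
  qed
  ultimately show ?thesis
    unfolding unital_hom_def by (auto simp: ring_mat_simps intro!: homI)
qed

end

text \<open>\<open>rot_mat\<close> is the companion matrix \<open>u\<close> of \<open>t\<^sup>2 + t + 1\<close>. The matrices \<open>refl_mat a d\<close> are all the
  solutions \<open>v\<close> of \<open>v u = u\<^sup>2 v\<close>, and the square of \<open>refl_mat a d\<close> is the scalar \<open>a\<^sup>2 - a d + d\<^sup>2\<close>.\<close>

definition rot_mat :: "'k::field mat"
  where "rot_mat = mat_of_rows_list 2 [[0, -1], [1, -1]]"

definition refl_mat :: "'k::field \<Rightarrow> 'k \<Rightarrow> 'k mat"
  where "refl_mat a d = mat_of_rows_list 2 [[a, d - a], [d, -a]]"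

lemma rot_mat_in: "rot_mat \<in> carrier_mat 2 2" and refl_mat_in: "refl_mat a d \<in> carrier_mat 2 2"
  by (auto simp: rot_mat_def refl_mat_def mat_of_rows_list_def)

lemma dim_rot_refl_mat [simp]:
  "dim_row rot_mat = 2" "dim_col rot_mat = 2" "dim_row (refl_mat a d) = 2" "dim_col (refl_mat a d) = 2"
  using rot_mat_in refl_mat_in by blast+

lemma mat_2_2_eqI:
  assumes "A \<in> carrier_mat 2 2" "B \<in> carrier_mat 2 2"
    "A $$ (0,0) = B $$ (0,0)" "A $$ (0,1) = B $$ (0,1)" "A $$ (1,0) = B $$ (1,0)" "A $$ (1,1) = B $$ (1,1)"
  shows "A = B"
  using assms by (intro eq_matI) (auto simp: less_2_cases_iff)

lemma mult_mat_2_2_index: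
  assumes "A \<in> carrier_mat 2 2" "B \<in> carrier_mat 2 2" "i < 2" "j < 2"
  shows "(A * B) $$ (i, j) = A $$ (i, 0) * B $$ (0, j) + A $$ (i, 1) * B $$ (1, j)"
  using assms by (simp add: scalar_prod_def numeral_2_eq_2)

lemma rot_mat_index [simp]:
  "rot_mat $$ (0, 0) = 0" "rot_mat $$ (0, Suc 0) = -1" "rot_mat $$ (Suc 0, 0) = 1" "rot_mat $$ (Suc 0, Suc 0) = -1"
  by (simp_all add: rot_mat_def mat_of_rows_list_def)

lemma refl_mat_index [simp]:
  "refl_mat a d $$ (0, 0) = a" "refl_mat a d $$ (0, Suc 0) = d - a"
  "refl_mat a d $$ (Suc 0, 0) = d" "refl_mat a d $$ (Suc 0, Suc 0) = -a"
  by (simp_all add: refl_mat_def mat_of_rows_list_def)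

lemmas mat_2_2_simps = mult_mat_2_2_index rot_mat_in refl_mat_in mult_carrier_mat[of _ 2 2 _ 2]

lemma rot_mat_pow_3: "rot_mat ^\<^sub>m 3 = (1\<^sub>m 2 :: 'k::field mat)"
proof -
  have "rot_mat ^\<^sub>m 3 = rot_mat * rot_mat * (rot_mat :: 'k mat)"
    using rot_mat_in[where 'a = 'k] by (simp add: numeral_3_eq_3)
  also have "\<dots> = 1\<^sub>m 2"
    by (rule mat_2_2_eqI) (auto simp: mat_2_2_simps simp del: index_mult_mat(1))
  finally show ?thesis .
qed

lemma refl_rot: "refl_mat a d * rot_mat = rot_mat ^\<^sub>m 2 * refl_mat a d"
proof -
  have "rot_mat ^\<^sub>m 2 = rot_mat * (rot_mat :: 'a mat)"
    using rot_mat_in[where 'a = 'a] by (simp add: numeral_2_eq_2)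
  then show ?thesis
    by (auto simp: mat_2_2_simps simp del: index_mult_mat(1) intro!: mat_2_2_eqI)
qed

text \<open>The matrix has trace 0 and determinant -c, so its square is the scalar c. The exponent
  is split by parity, leaving e = 0 or e = 1 in the applications to coordinates.\<close>

lemma refl_mat_pow:
  assumes c: "a * a - a * d + d * d = c"
  shows "refl_mat a d ^\<^sub>m (2 * m + e) = c ^ m \<cdot>\<^sub>m (refl_mat a d ^\<^sub>m e)"
proof (induction m)
  case (Suc m)
  let ?v = "refl_mat a d"
  have sq: "?v * ?v = c \<cdot>\<^sub>m 1\<^sub>m 2"
    by (rule mat_2_2_eqI) (auto simp: mat_2_2_simps c[symmetric] algebra_simps simp del: index_mult_mat(1))
  have Yn: "?v ^\<^sub>m n \<in> carrier_mat 2 2" for n by (rule pow_carrier_mat[OF refl_mat_in])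
  have "?v ^\<^sub>m (2 * Suc m + e) = ?v ^\<^sub>m (2 * m + e) * ?v * ?v" by simp
  also have "\<dots> = ?v ^\<^sub>m (2 * m + e) * (?v * ?v)"
    by (rule assoc_mult_mat[OF Yn refl_mat_in refl_mat_in])
  also have "\<dots> = c \<cdot>\<^sub>m (?v ^\<^sub>m (2 * m + e))"
    unfolding sq using Yn[of "2 * m + e"] by (subst mult_smult_distrib[of _ 2 2 _ 2]) auto
  also have "\<dots> = c ^ Suc m \<cdot>\<^sub>m (?v ^\<^sub>m e)"
    unfolding Suc by (intro eq_matI) (auto simp: mult.assoc)
  finally show ?case .
qed (use refl_mat_in[of a d] in \<open>auto intro!: eq_matI\<close>)

text \<open>The image of x^i y^j in the quaternion algebra with v^2 = c, split by a solution
  \<alpha>, \<delta> of the norm equation for c.\<close>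

definition quat_word :: "'k::field \<Rightarrow> 'k \<Rightarrow> nat \<times> nat \<Rightarrow> 'k mat"
  where "quat_word \<alpha> \<delta> p = word (ring_mat TYPE('k) 2 ()) rot_mat (refl_mat \<alpha> \<delta>) p"

definition quat_rep :: "('f \<Rightarrow> 'k::field) \<Rightarrow> 'k \<Rightarrow> 'k \<Rightarrow> (nat \<times> nat \<Rightarrow> 'f) \<Rightarrow> 'k mat"
  where "quat_rep \<kappa> \<alpha> \<delta> a = mat 2 2 (\<lambda>ij. lin_eval \<kappa> (\<lambda>p. quat_word \<alpha> \<delta> p $$ ij) a)"

lemma (in C3_rtimes_C8) quat_rep_hom:
  assumes \<kappa>: "field_hom (\<kappa> :: 'f \<Rightarrow> 'k::field)"
    and c: "\<alpha> * \<alpha> - \<alpha> * \<delta> + \<delta> * \<delta> = c" "c ^ 4 = 1"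
  shows "(\<lambda>a. quat_rep \<kappa> \<alpha> \<delta> (a \<circ> elem)) \<in> unital_hom (group_algebra TYPE('f::field) G) (ring_mat TYPE('k) 2 ())"
  unfolding quat_rep_def quat_word_def
proof (rule representation_hom[OF \<kappa> rot_mat_in _ refl_mat_in])
  show "rot_mat [^]\<^bsub>ring_mat TYPE('k) 2 ()\<^esub> (3::nat) = 1\<^sub>m 2"
    by (simp add: rot_mat_pow_3 flip: pow_mat_ring_pow[OF rot_mat_in])
  show "refl_mat \<alpha> \<delta> [^]\<^bsub>ring_mat TYPE('k) 2 ()\<^esub> (8::nat) = 1\<^sub>m 2"
    \<comment> \<open>The eighth power of the reflection matrix is the scalar c^4 = 1.\<close>
    using refl_mat_pow[OF c(1), of 4 0] c(2) refl_mat_in[of \<alpha> \<delta>]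
    by (auto simp flip: pow_mat_ring_pow[OF refl_mat_in] intro!: eq_matI)
  show "refl_mat \<alpha> \<delta> * rot_mat = rot_mat [^]\<^bsub>ring_mat TYPE('k) 2 ()\<^esub> (2::nat) * refl_mat \<alpha> \<delta>"
    by (simp add: refl_rot flip: pow_mat_ring_pow[OF rot_mat_in])
qed

lemma quat_word_index:
  assumes c: "\<alpha> * \<alpha> - \<alpha> * \<delta> + \<delta> * \<delta> = c" and ij: "i < 2" "j < 2"
  shows "quat_word \<alpha> \<delta> (l, 2 * m + e) $$ (i, j) = c ^ m * (rot_mat ^\<^sub>m l * refl_mat \<alpha> \<delta> ^\<^sub>m e) $$ (i, j)"
proof -
  let ?r = "rot_mat ^\<^sub>m l" and ?v = "refl_mat \<alpha> \<delta> ^\<^sub>m e"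
  have in22: "?r \<in> carrier_mat 2 2" "?v \<in> carrier_mat 2 2"
    by (rule pow_carrier_mat, rule rot_mat_in) (rule pow_carrier_mat, rule refl_mat_in)
  have "quat_word \<alpha> \<delta> (l, 2 * m + e) = ?r * (c ^ m \<cdot>\<^sub>m ?v)"
    unfolding quat_word_def word_def
    by (simp add: ring_mat_simps refl_mat_pow[OF c] flip: pow_mat_ring_pow[OF rot_mat_in] pow_mat_ring_pow[OF refl_mat_in])
  also have "\<dots> = c ^ m \<cdot>\<^sub>m (?r * ?v)"
    by (rule mult_smult_distrib[OF in22])
  finally show ?thesis using ij by simp
qed

section \<open>Vanishing conditions and recovery of the coefficients\<close>

lemma lin_eval_eq_sum:
  "lin_eval \<kappa> f a = (\<Sum>i<3. \<Sum>j<8. \<kappa> (a (i, j)) * f (i, j))"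
  by (simp add: lin_eval_def exponents_def sum.cartesian_product case_prod_unfold)

lemma sum_lessThan_8_parity:
  fixes f :: "nat \<Rightarrow> 'b::comm_monoid_add"
  shows "(\<Sum>j<8. f j) = (\<Sum>e<2. \<Sum>m<4. f (2 * m + e))"
  by (simp add: eval_nat_numeral ac_simps)

text \<open>The condition says that the character \<open>x \<mapsto> 1, y \<mapsto> z\<close> vanishes at \<open>a\<close>.\<close>

definition char_vanish :: "('f \<Rightarrow> 'k::field) \<Rightarrow> 'k \<Rightarrow> (nat \<times> nat \<Rightarrow> 'f::field) \<Rightarrow> bool"
  where "char_vanish \<kappa> z a \<longleftrightarrow> (\<Sum>j<8. \<kappa> (\<Sum>i<3. a (i, j)) * z ^ j) = 0"

text \<open>With \<open>y\<^sup>2 = c\<close> and \<open>x\<^sup>2 = -1 - x\<close>, these sums are the coordinates of the image of \<open>a\<close>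
  with respect to the basis \<open>1, x, y, x y\<close>.\<close>

definition quat_vanish :: "('f \<Rightarrow> 'k::field) \<Rightarrow> 'k \<Rightarrow> (nat \<times> nat \<Rightarrow> 'f::field) \<Rightarrow> bool"
  where "quat_vanish \<kappa> c a \<longleftrightarrow>
    (\<forall>i<2. \<forall>e<2. (\<Sum>m<4. \<kappa> (a (i, 2 * m + e) - a (2, 2 * m + e)) * c ^ m) = 0)"

lemma lin_eval_diff:
  assumes "field_hom \<kappa>"
  shows "lin_eval \<kappa> f (\<lambda>p. a p - b p) = lin_eval \<kappa> f a - lin_eval \<kappa> f b"
proof -
  interpret field_hom \<kappa> by fact
  show ?thesis by (simp add: lin_eval_def hom_minus left_diff_distrib sum_subtractf)
qed

lemma char_vanish_if_eq:
  assumes \<kappa>: "field_hom \<kappa>" and "lin_eval \<kappa> (\<lambda>p. z ^ snd p) a = lin_eval \<kappa> (\<lambda>p. z ^ snd p) b"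
  shows "char_vanish \<kappa> z (\<lambda>p. a p - b p)"
proof -
  interpret field_hom \<kappa> by fact
  have "lin_eval \<kappa> (\<lambda>p. z ^ snd p) (\<lambda>p. a p - b p) = 0" using assms by (simp add: lin_eval_diff)
  then show ?thesis
    unfolding char_vanish_def lin_eval_eq_sum
    by (subst (asm) sum.swap) (simp add: hom_sum sum_distrib_right)
qed

text \<open>The four equations are the entries of s + \<beta> u + \<gamma> v + t u v = 0.
  Eliminating s and \<beta> leaves a 2 x 2 system in \<gamma> and t, of determinant -3 (\<alpha>^2 -
  \<alpha> \<delta> + \<delta>^2).\<close>

lemma quat_basis_independent:
  fixes \<alpha> \<delta> :: "'k::field"
  assumes n: "3 * (\<alpha> * \<alpha> - \<alpha> * \<delta> + \<delta> * \<delta>) \<noteq> 0"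
    and e00: "s + \<gamma> * \<alpha> - t * \<delta> = 0"
    and e01: "- \<beta> + \<gamma> * (\<delta> - \<alpha>) + t * \<alpha> = 0"
    and e10: "\<beta> + \<gamma> * \<delta> + t * (\<alpha> - \<delta>) = 0"
    and e11: "s - \<beta> - \<gamma> * \<alpha> + t * \<delta> = 0"
  shows "s = 0 \<and> \<beta> = 0 \<and> \<gamma> = 0 \<and> t = 0"
proof -
  have E1: "\<gamma> * (2 * \<delta> - \<alpha>) + t * (2 * \<alpha> - \<delta>) = 0"
  proof -
    have "\<gamma> * (2 * \<delta> - \<alpha>) + t * (2 * \<alpha> - \<delta>) =
      (- \<beta> + \<gamma> * (\<delta> - \<alpha>) + t * \<alpha>) + (\<beta> + \<gamma> * \<delta> + t * (\<alpha> - \<delta>))" by (simp add: algebra_simps)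
    then show ?thesis by (simp only: e01 e10 add_0)
  qed
  have E2: "\<gamma> * (2 * \<alpha> - \<delta>) - t * (\<alpha> + \<delta>) = 0"
  proof -
    have "\<gamma> * (2 * \<alpha> - \<delta>) - t * (\<alpha> + \<delta>) = (s + \<gamma> * \<alpha> - t * \<delta>) - (s - \<beta> - \<gamma> * \<alpha> + t * \<delta>)
      - (\<beta> + \<gamma> * \<delta> + t * (\<alpha> - \<delta>))" by (simp add: algebra_simps)
    then show ?thesis by (simp only: e00 e10 e11 diff_self)
  qed
  \<comment> \<open>Numerals are unfolded to sums of 1 so that distributivity expands both sides to
    the same monomials. The two identities below are Cramer's rule for \<open>E1\<close> and
    \<open>E2\<close>.\<close>
  have three: "3 = (1 + 1 + 1 :: 'k)" "2 = (1 + 1 :: 'k)" by simp_all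
  have "3 * (\<alpha> * \<alpha> - \<alpha> * \<delta> + \<delta> * \<delta>) * \<gamma> =
      (\<gamma> * (2 * \<delta> - \<alpha>) + t * (2 * \<alpha> - \<delta>)) * (\<alpha> + \<delta>) + (\<gamma> * (2 * \<alpha> - \<delta>) - t * (\<alpha> + \<delta>)) * (2 * \<alpha> - \<delta>)"
    unfolding three by (simp only: ring_distribs mult_1 mult_1_right add_ac mult_ac diff_conv_add_uminus minus_add_distrib) (simp add: algebra_simps)
  then have "\<gamma> = 0" using n by (simp add: E1 E2)
  have "3 * (\<alpha> * \<alpha> - \<alpha> * \<delta> + \<delta> * \<delta>) * t =
      (\<gamma> * (2 * \<delta> - \<alpha>) + t * (2 * \<alpha> - \<delta>)) * (2 * \<alpha> - \<delta>) - (\<gamma> * (2 * \<alpha> - \<delta>) - t * (\<alpha> + \<delta>)) * (2 * \<delta> - \<alpha>)"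
    unfolding three by (simp only: ring_distribs mult_1 mult_1_right add_ac mult_ac diff_conv_add_uminus minus_add_distrib) (simp add: algebra_simps)
  then have "t = 0" using n by (simp add: E1 E2)
  with \<open>\<gamma> = 0\<close> e00 e10 show ?thesis by simp
qed

lemma quat_vanish_if_eq:
  fixes \<kappa> :: "'f::field \<Rightarrow> 'k::field"
  assumes \<kappa>: "field_hom \<kappa>" and c: "\<alpha> * \<alpha> - \<alpha> * \<delta> + \<delta> * \<delta> = c" "c \<noteq> 0" and three: "(3::'k) \<noteq> 0"
    and eq: "quat_rep \<kappa> \<alpha> \<delta> a = quat_rep \<kappa> \<alpha> \<delta> b"
  shows "quat_vanish \<kappa> c (\<lambda>p. a p - b p)"
proof -
  interpret field_hom \<kappa> by fact
  \<comment> \<open>\<open>C l e\<close> is the coefficient of u^l v^e after v^2 = c has absorbed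
    the even part of the exponent of y.\<close>
  define C where "C l e = (\<Sum>m<4. \<kappa> (a (l, 2 * m + e) - b (l, 2 * m + e)) * c ^ m)" for l e
  let ?M = "\<lambda>l e. rot_mat ^\<^sub>m l * refl_mat \<alpha> \<delta> ^\<^sub>m e"
  have M: "?M 0 0 = 1\<^sub>m 2" "?M 1 0 = rot_mat" "?M 2 0 = rot_mat * rot_mat"
    "?M 0 1 = refl_mat \<alpha> \<delta>" "?M 1 1 = rot_mat * refl_mat \<alpha> \<delta>" "?M 2 1 = rot_mat * rot_mat * refl_mat \<alpha> \<delta>"
    using rot_mat_in[where 'a = 'k] refl_mat_in[of \<alpha> \<delta>] by (simp_all add: numeral_2_eq_2)
  have sum0: "(\<Sum>l<3. \<Sum>e<2. C l e * ?M l e $$ (i, j)) = 0" if ij: "i < 2" "j < 2" for i j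
  proof -
    let ?f = "\<lambda>p. quat_word \<alpha> \<delta> p $$ (i, j)"
    have "lin_eval \<kappa> ?f a = lin_eval \<kappa> ?f b"
      using arg_cong[OF eq, of "\<lambda>M. M $$ (i, j)"] ij by (simp add: quat_rep_def)
    then have "lin_eval \<kappa> ?f (\<lambda>p. a p - b p) = 0" by (simp add: lin_eval_diff[OF \<kappa>])
    then show ?thesis
      unfolding lin_eval_eq_sum sum_lessThan_8_parity
      by (simp add: quat_word_index[OF c(1) ij] C_def sum_distrib_right mult.assoc)
  qed
  \<comment> \<open>Replacing u^2 by -1 - u subtracts the coefficients of u^2 from those of 1 and
    u.\<close>
  let ?s = "C 0 0 - C 2 0" and ?b = "C 1 0 - C 2 0" and ?g = "C 0 1 - C 2 1" and ?t = "C 1 1 - C 2 1"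
  have expand: "(\<Sum>l<3. \<Sum>e<2. f l e) = f 0 0 + f 0 1 + f 1 0 + f 1 1 + f 2 0 + f 2 1"
    for f :: "nat \<Rightarrow> nat \<Rightarrow> 'k" by (simp add: eval_nat_numeral)
  note sums = sum0[unfolded expand M]
  have "?s = 0 \<and> ?b = 0 \<and> ?g = 0 \<and> ?t = 0"
  proof (rule quat_basis_independent)
    show "3 * (\<alpha> * \<alpha> - \<alpha> * \<delta> + \<delta> * \<delta>) \<noteq> 0" using c three by simp
    show "?s + ?g * \<alpha> - ?t * \<delta> = 0"
      using sums[of 0 0] by (simp add: mat_2_2_simps algebra_simps del: index_mult_mat(1))
    show "- ?b + ?g * (\<delta> - \<alpha>) + ?t * \<alpha> = 0"
      using sums[of 0 1] by (simp add: mat_2_2_simps algebra_simps del: index_mult_mat(1))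
    show "?b + ?g * \<delta> + ?t * (\<alpha> - \<delta>) = 0"
      using sums[of 1 0] by (simp add: mat_2_2_simps algebra_simps del: index_mult_mat(1))
    show "?s - ?b - ?g * \<alpha> + ?t * \<delta> = 0"
      using sums[of 1 1] by (simp add: mat_2_2_simps algebra_simps del: index_mult_mat(1))
  qed
  then have "C i e - C 2 e = 0" if "i < 2" "e < 2" for i e
    using that by (auto simp: less_2_cases_iff)
  moreover have "(\<Sum>m<4. \<kappa> ((a (i, 2 * m + e) - b (i, 2 * m + e)) - (a (2, 2 * m + e) - b (2, 2 * m + e))) * c ^ m) = C i e - C 2 e" for i e
    unfolding C_def by (simp add: hom_minus left_diff_distrib sum_subtractf)
  ultimately show ?thesis by (simp add: quat_vanish_def)
qed

text \<open>Equations found over F are carried into the field containing z, where all roots are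
  counted together.\<close>

lemma char_vanish_field_hom:
  assumes "field_hom \<iota>" "char_vanish id z a"
  shows "char_vanish \<iota> (\<iota> z) a"
proof -
  interpret field_hom \<iota> by fact
  show ?thesis
    using arg_cong[OF assms(2)[unfolded char_vanish_def], of \<iota>]
    by (simp only: char_vanish_def id_apply hom_sum hom_mult hom_power hom_zero)
qed

lemma quat_vanish_field_hom:
  assumes "field_hom \<iota>" "quat_vanish id c a"
  shows "quat_vanish \<iota> (\<iota> c) a"
proof -
  interpret field_hom \<iota> by fact
  have "(\<Sum>m<4. \<iota> (a (i, 2 * m + e) - a (2, 2 * m + e)) * \<iota> c ^ m) = 0" if "i < 2" "e < 2" for i e
  proof -
    have "(\<Sum>m<4. (a (i, 2 * m + e) - a (2, 2 * m + e)) * c ^ m) = 0"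
      using assms(2) that by (simp add: quat_vanish_def)
    from arg_cong[OF this, of \<iota>] show ?thesis by (simp only: hom_sum hom_mult hom_power hom_zero)
  qed
  then show ?thesis by (simp add: quat_vanish_def)
qed

lemma vanish_conjugate:
  fixes \<iota> :: "'f::{field,finite} \<Rightarrow> 'e::field"
  assumes "field_hom \<iota>" "Factorial_Ring.prime CHAR('e)" "CARD('f) = CHAR('e) ^ k"
  shows "char_vanish \<iota> z a \<Longrightarrow> char_vanish \<iota> (z ^ CARD('f)) a"
    and "quat_vanish \<iota> z a \<Longrightarrow> quat_vanish \<iota> (z ^ CARD('f)) a"
  unfolding char_vanish_def quat_vanish_def
  using frobenius_conjugate_root[OF assms, where z = z and n = 8 and c = "\<lambda>j. \<Sum>i<3. a (i, j)"]
    frobenius_conjugate_root[OF assms, where z = z and n = 4 and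
      c = "\<lambda>m. a (i, 2 * m + e) - a (2, 2 * m + e)" for i e]
  by blast+

text \<open>The order of z is exactly 8: if z^d = 1 with 0 < d < 8, then some multiple of d is 4 r
  with r odd, and (-1)^r = 1 contradicts 2 being nonzero.\<close>

lemma inj_on_power_of_order_8:
  fixes z :: "'e::field"
  assumes z: "z ^ 4 = -1" and two: "(2::'e) \<noteq> 0"
  shows "inj_on (\<lambda>k. z ^ k) {..<8}"
proof -
  have z0: "z \<noteq> 0" using z by auto
  have ne: "(1::'e) \<noteq> -1" using two by (metis add.right_inverse one_add_one)
  have no: "z ^ d \<noteq> 1" if "0 < d" "d < 8" for d
  proof
    assume d: "z ^ d = 1"
    have "odd r \<Longrightarrow> (z ^ 4) ^ r \<noteq> 1" for r using ne by (simp add: z)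
    moreover have "(z ^ 4) ^ r = 1" if "4 * r = d * l" for r l
      using that d by (metis power_mult power_one)
    moreover have "\<exists>r l. odd r \<and> 4 * r = d * l"
    proof -
      from that consider "odd d" | "d = 2" | "d = 6" | "d = 4" by fastforce
      then show ?thesis
      proof cases
        case 1 then show ?thesis by (intro exI[of _ d] exI[of _ 4]) simp
      next
        case 2 then show ?thesis by (intro exI[of _ 1] exI[of _ 2]) simp
      next
        case 3 then show ?thesis by (intro exI[of _ 3] exI[of _ 2]) simp
      next
        case 4 then show ?thesis by (intro exI[of _ 1] exI[of _ 1]) simp
      qed
    qed
    ultimately show False by blast
  qed
  have "k = l" if "z ^ k = z ^ l" "k \<le> l" "l < 8" for k l
  proof (rule ccontr)
    assume "k \<noteq> l"
    have "z ^ l = z ^ k * z ^ (l - k)" using that(2) by (simp flip: power_add)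
    then have "z ^ (l - k) = 1" using that(1) z0 by simp
    then show False using no[of "l - k"] \<open>k \<noteq> l\<close> that by simp
  qed
  then show ?thesis by (metis inj_onI lessThan_iff nle_le)
qed

text \<open>For each j, the eight characters force the coefficients of y^j, x y^j, x^2 y^j to have
  sum 0, and the four values of c force them to be equal. Three times each is then 0.\<close>

lemma coeffs_eq_0_if_vanish:
  fixes \<iota> :: "'f::field \<Rightarrow> 'e::field" and z :: 'e
  assumes \<iota>: "field_hom \<iota>" and z: "z ^ 4 = -1" and two: "(2::'e) \<noteq> 0" and three: "(3::'e) \<noteq> 0"
    and ch: "\<And>k. k < 8 \<Longrightarrow> char_vanish \<iota> (z ^ k) a"
    and qu: "\<And>k. k < 4 \<Longrightarrow> quat_vanish \<iota> (z ^ (2 * k)) a"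
    and p: "p \<in> exponents"
  shows "a p = 0"
proof -
  interpret field_hom \<iota> by fact
  have inj: "inj_on (\<lambda>k. z ^ k) {..<8}" by (rule inj_on_power_of_order_8) fact+
  have s0: "\<iota> (\<Sum>i<3. a (i, j)) = 0" if "j < 8" for j
  proof (rule coeffs_eq_0_if_many_roots[where Z = "(\<lambda>k. z ^ k) ` {..<8}" and n = 8
        and c = "\<lambda>j. \<iota> (\<Sum>i<3. a (i, j))" and j = j])
    show "8 \<le> card ((\<lambda>k. z ^ k) ` {..<8})" using card_image[OF inj] by simp
  qed (use ch that in \<open>auto simp: char_vanish_def\<close>)
  have inj2: "inj_on (\<lambda>k. z ^ (2 * k)) {..<4}"
  proof (rule inj_onI)
    fix k l :: nat assume "k \<in> {..<4}" "l \<in> {..<4}" "z ^ (2 * k) = z ^ (2 * l)"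
    then have "2 * k = 2 * l" by (intro inj_onD[OF inj]) auto
    then show "k = l" by simp
  qed
  have d0: "\<iota> (a (i, 2 * m + e) - a (2, 2 * m + e)) = 0" if "i < 2" "e < 2" "m < 4" for i e m
  proof (rule coeffs_eq_0_if_many_roots[where Z = "(\<lambda>k. z ^ (2 * k)) ` {..<4}" and n = 4
        and c = "\<lambda>m. \<iota> (a (i, 2 * m + e) - a (2, 2 * m + e))" and j = m])
    show "4 \<le> card ((\<lambda>k. z ^ (2 * k)) ` {..<4})" using card_image[OF inj2] by simp
  qed (use qu that in \<open>auto simp: quat_vanish_def\<close>)
  obtain i j where ij: "p = (i, j)" "i < 3" "j < 8" using p by (auto simp: exponents_def)
  have eq: "a (l, j) = a (2, j)" if "l < 3" for l
  proof (cases "l = 2")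
    case False
    then have "l < 2" using that by simp
    then show ?thesis using d0[of l "j mod 2" "j div 2"] ij(3) by simp
  qed simp
  have "(\<Sum>l<3. a (l, j)) = (\<Sum>l<3::nat. a (2, j))" by (rule sum.cong[OF refl]) (rule eq, simp)
  moreover have "(\<Sum>l<3. a (l, j)) = 0" using s0[OF ij(3)] by simp
  moreover have "(3::'f) \<noteq> 0" using three hom_0_iff[of 3] by (simp add: hom_numeral)
  ultimately show ?thesis using eq[OF ij(2)] ij(1) by simp
qed

subsection \<open>The three types of decomposition\<close>

lemma field_hom_id: "field_hom (id :: 'f::field \<Rightarrow> 'f)"
  by unfold_locales auto

lemma finite_subring_UNIV: "finite (UNIV :: 'k::field set) \<Longrightarrow> finite_subring (UNIV :: 'k set)"
  by (simp add: finite_subring_def)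

lemma card_group_power_ring_mat:
  assumes "finite (UNIV :: 'k::field set)"
  shows "finite (carrier (group_power (ring_mat TYPE('k) 2 ()) m))"
    and "card (carrier (group_power (ring_mat TYPE('k) 2 ()) m)) \<le> CARD('k) ^ (4 * m)"
  using card_group_power[of "ring_mat TYPE('k) 2 ()" m] finite_carrier_mat_2_2[OF assms]
  by (simp_all add: ring_mat_simps power_mult power_mono)

lemma ex_norm_family:
  fixes c :: "nat \<Rightarrow> 'k::field"
  assumes "finite (UNIV :: 'k set)" "(2::'k) \<noteq> 0" "(3::'k) \<noteq> 0"
  obtains \<alpha> \<delta> where "\<And>i. \<alpha> i * \<alpha> i - \<alpha> i * \<delta> i + \<delta> i * \<delta> i = c i"
proof -
  have "\<forall>i. \<exists>ad. fst ad * fst ad - fst ad * snd ad + snd ad * snd ad = c i"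
    using norm_form_eisenstein_surj[OF assms] by simp
  then obtain ad where "\<forall>i. fst (ad i) * fst (ad i) - fst (ad i) * snd (ad i) + snd (ad i) * snd (ad i) = c i"
    by (rule choice[THEN exE])
  then show ?thesis using that[of "\<lambda>i. fst (ad i)" "\<lambda>i. snd (ad i)"] by simp
qed

context C3_rtimes_C8
begin

lemma group_power_character_hom:
  assumes \<kappa>: "field_hom (\<kappa> :: 'f \<Rightarrow> 'k::field)" and z: "\<And>i. i < m \<Longrightarrow> z i ^ 8 = (1::'k)"
    and S: "\<And>i a. i < m \<Longrightarrow> lin_eval \<kappa> (\<lambda>p. z i ^ snd p) a \<in> S"
  shows "(\<lambda>a. \<lambda>i\<in>{..<m}. lin_eval \<kappa> (\<lambda>p. z i ^ snd p) (a \<circ> elem))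
    \<in> unital_hom (group_algebra TYPE('f::field) G) (group_power (ring_on S) m)"
  by (rule unital_hom_group_power) (rule character_hom[OF \<kappa> z S])

lemma group_power_quat_rep_hom:
  assumes \<kappa>: "field_hom (\<kappa> :: 'f \<Rightarrow> 'k::field)"
    and c: "\<And>i. \<alpha> i * \<alpha> i - \<alpha> i * \<delta> i + \<delta> i * \<delta> i = c i" "\<And>i. i < m \<Longrightarrow> c i ^ 4 = 1"
  shows "(\<lambda>a. \<lambda>i\<in>{..<m}. quat_rep \<kappa> (\<alpha> i) (\<delta> i) (a \<circ> elem))
    \<in> unital_hom (group_algebra TYPE('f::field) G) (group_power (ring_mat TYPE('k) 2 ()) m)"
  by (rule unital_hom_group_power) (rule quat_rep_hom[OF \<kappa> c])

lemma character_family_vanish: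
  assumes \<kappa>: "field_hom \<kappa>"
    and eq: "(\<lambda>i\<in>{..<m}. lin_eval \<kappa> (\<lambda>p. z i ^ snd p) (a \<circ> elem)) = (\<lambda>i\<in>{..<m}. lin_eval \<kappa> (\<lambda>p. z i ^ snd p) (b \<circ> elem))"
    and i: "i < m"
  shows "char_vanish \<kappa> (z i) (\<lambda>p. a (elem p) - b (elem p))"
  using char_vanish_if_eq[OF \<kappa>, of "z i" "a \<circ> elem" "b \<circ> elem"] fun_cong[OF eq, of i] i by simp

lemma quat_family_vanish:
  fixes \<kappa> :: "'f::field \<Rightarrow> 'k::field"
  assumes \<kappa>: "field_hom \<kappa>" and three: "(3::'k) \<noteq> 0"
    and c: "\<And>i. \<alpha> i * \<alpha> i - \<alpha> i * \<delta> i + \<delta> i * \<delta> i = c i" "\<And>i. i < m \<Longrightarrow> c i ^ 4 = 1"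
    and eq: "(\<lambda>i\<in>{..<m}. quat_rep \<kappa> (\<alpha> i) (\<delta> i) (a \<circ> elem)) = (\<lambda>i\<in>{..<m}. quat_rep \<kappa> (\<alpha> i) (\<delta> i) (b \<circ> elem))"
    and i: "i < m"
  shows "quat_vanish \<kappa> (c i) (\<lambda>p. a (elem p) - b (elem p))"
proof -
  have "c i \<noteq> 0" using c(2)[OF i] by auto
  then show ?thesis
    using quat_vanish_if_eq[OF \<kappa> c(1) _ three, of i "a \<circ> elem" "b \<circ> elem"] fun_cong[OF eq, of i] i by simp
qed

text \<open>All eighth roots of unity are in F, so every representation is defined over F; the
  dimensions give 8 + 4 * 4 = 24.\<close>

lemma units_iso_if_eighth_root:
  fixes z :: "'f::{field,finite}"
  assumes z: "z ^ 4 = -1" and two: "(2::'f) \<noteq> 0" and three: "(3::'f) \<noteq> 0"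
  shows "units_of (group_algebra TYPE('f) G) \<cong>
    group_power (integer_mod_group (CARD('f) - 1)) 8 \<times>\<times> group_power (general_linear_group 2 TYPE('f)) 4"
proof -
  let ?FG = "group_algebra TYPE('f) G"
  let ?B1 = "group_power (ring_on (UNIV :: 'f set)) 8" and ?B2 = "group_power (ring_mat TYPE('f) 2 ()) 4"
  obtain \<alpha> \<delta> :: "nat \<Rightarrow> 'f" where norm: "\<And>i. \<alpha> i * \<alpha> i - \<alpha> i * \<delta> i + \<delta> i * \<delta> i = z ^ (2 * i)"
    by (rule ex_norm_family[OF finite two three, where c = "\<lambda>i. z ^ (2 * i)"]) blast
  have z8: "z ^ 8 = 1" using power_mult[of z 4 2] z by simp
  have z8i: "(z ^ i) ^ 8 = 1" and z2i: "(z ^ (2 * i)) ^ 4 = 1" for i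
    using power_mult[of z 8 i] z8 by (simp_all add: mult_ac flip: power_mult)
  let ?f1 = "\<lambda>a. \<lambda>i\<in>{..<8}. lin_eval id (\<lambda>p. (z ^ i) ^ snd p) (a \<circ> elem)"
  let ?f2 = "\<lambda>a. \<lambda>i\<in>{..<4}. quat_rep id (\<alpha> i) (\<delta> i) (a \<circ> elem)"
  let ?f = "\<lambda>a. (?f1 a, ?f2 a)"
  have "?f1 \<in> unital_hom ?FG ?B1"
    by (rule group_power_character_hom[OF field_hom_id]) (use z8i in auto)
  moreover have "?f2 \<in> unital_hom ?FG ?B2"
    by (rule group_power_quat_rep_hom[OF field_hom_id norm z2i])
  ultimately have hom: "?f \<in> unital_hom ?FG (?B1 \<times>\<times> ?B2)" by (rule unital_hom_DirProd)
  have "units_of ?FG \<cong> units_of (?B1 \<times>\<times> ?B2)"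
  proof (rule units_group_algebra_iso[OF hom])
    fix a b :: "'a \<Rightarrow> 'f" and p
    assume eq: "?f a = ?f b" and p: "p \<in> exponents"
    have "char_vanish id (z ^ i) (\<lambda>p. a (elem p) - b (elem p))" if "i < 8" for i
      by (rule character_family_vanish[OF field_hom_id _ that]) (use eq in blast)
    moreover have "quat_vanish id (z ^ (2 * i)) (\<lambda>p. a (elem p) - b (elem p))" if "i < 4" for i
      by (rule quat_family_vanish[OF field_hom_id three norm z2i _ that]) (use eq in blast)
    ultimately have "a (elem p) - b (elem p) = 0"
      by (rule coeffs_eq_0_if_vanish[OF field_hom_id z two three _ _ p])
    then show "a (elem p) = b (elem p)" by simp
  next
    have 1: "finite (carrier ?B1)" "card (carrier ?B1) = CARD('f) ^ 8"
      using card_group_power[of "ring_on (UNIV :: 'f set)"] by (simp_all add: ring_on_def)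
    note 2 = card_group_power_ring_mat[where 'k = 'f and m = 4, OF finite]
    show "finite (carrier (?B1 \<times>\<times> ?B2))" using 1(1) 2(1) by simp
    have "card (carrier (?B1 \<times>\<times> ?B2)) = CARD('f) ^ 8 * card (carrier ?B2)"
      by (simp add: card_cartesian_product 1(2))
    also have "\<dots> \<le> CARD('f) ^ 8 * CARD('f) ^ (4 * 4)" by (rule mult_le_mono2[OF 2(2)])
    also have "\<dots> = CARD('f) ^ 24" by (simp flip: power_add)
    finally show "card (carrier (?B1 \<times>\<times> ?B2)) \<le> CARD('f) ^ 24" .
  qed
  also have "units_of (?B1 \<times>\<times> ?B2) \<cong>
      group_power (integer_mod_group (CARD('f) - 1)) 8 \<times>\<times> group_power (general_linear_group 2 TYPE('f)) 4"
    unfolding units_of_DirProd units_group_power_ring_mat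
    by (intro group.DirProd_iso_trans units_group_power_ring_on_iso finite_subring_UNIV iso_refl finite)
  finally show ?thesis .
qed

text \<open>On exponents of z, Frobenius has the orbits {0}, {4}, {2, 6}, and further {1, 3}, {5, 7}
  if q = 3, or {1, 7}, {3, 5} if q = 7 modulo 8. The scalars c have the orbits {0}, {4}, {2, 6}. The
  dimensions give 2 + 3 * 2 + 2 * 4 + 2 * 4 = 24.\<close>

lemma units_iso_if_card_mod_8_eq_3_or_7:
  fixes \<iota> :: "'f::{field,finite} \<Rightarrow> 'e::field" and z :: 'e
  assumes \<iota>: "field_hom \<iota>" and char: "Factorial_Ring.prime CHAR('e)" "CARD('f) = CHAR('e) ^ k"
    and finE: "finite (UNIV :: 'e set)" and cardE: "CARD('e) = CARD('f) ^ 2"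
    and z: "z ^ 4 = -1" and two: "(2::'f) \<noteq> 0" and three: "(3::'f) \<noteq> 0"
    and q: "CARD('f) mod 8 = 3 \<or> CARD('f) mod 8 = 7"
  shows "units_of (group_algebra TYPE('f) G) \<cong>
    group_power (integer_mod_group (CARD('f) - 1)) 2 \<times>\<times>
    group_power (integer_mod_group (CARD('f) ^ 2 - 1)) 3 \<times>\<times>
    group_power (general_linear_group 2 TYPE('f)) 2 \<times>\<times>
    general_linear_group 2 TYPE('e)"
proof -
  interpret \<iota>: field_hom \<iota> by fact
  let ?FG = "group_algebra TYPE('f) G"
  let ?B1 = "group_power (ring_on (UNIV :: 'f set)) 2" and ?B2 = "group_power (ring_on (UNIV :: 'e set)) 3"
  let ?B3 = "group_power (ring_mat TYPE('f) 2 ()) 2" and ?B4 = "ring_mat TYPE('e) 2 ()"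
  let ?B = "?B1 \<times>\<times> ?B2 \<times>\<times> ?B3 \<times>\<times> ?B4"
  have twoE: "(2::'e) \<noteq> 0" using two \<iota>.hom_0_iff[of 2] by (simp add: \<iota>.hom_numeral)
  have threeE: "(3::'e) \<noteq> 0" using three \<iota>.hom_0_iff[of 3] by (simp add: \<iota>.hom_numeral)
  obtain \<alpha> \<delta> :: "nat \<Rightarrow> 'f" where norm: "\<And>i. \<alpha> i * \<alpha> i - \<alpha> i * \<delta> i + \<delta> i * \<delta> i = (-1) ^ i"
    by (rule ex_norm_family[OF finite two three, where c = "\<lambda>i. (-1) ^ i"]) blast
  obtain \<alpha>' \<delta>' :: 'e where norm': "\<alpha>' * \<alpha>' - \<alpha>' * \<delta>' + \<delta>' * \<delta>' = z ^ 2"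
    using norm_form_eisenstein_surj[OF finE twoE threeE] by blast
  have z8: "z ^ 8 = 1" using power_mult[of z 4 2] z by simp
  have z8i: "(z ^ i) ^ 8 = 1" for i
    using power_mult[of z 8 i] z8 by (simp add: mult_ac flip: power_mult)
  have z24: "(z ^ 2) ^ 4 = 1" using z8 by (simp flip: power_mult)
  have m1: "((-1) ^ i) ^ 8 = (1::'f)" "((-1) ^ i) ^ 4 = (1::'f)" for i :: nat
    by (simp_all flip: power_mult)
  \<comment> \<open>As \<open>q\<close> is 3 or 7 modulo 8, both \<open>z\<close> and \<open>z\<^sup>5\<close>, besides \<open>z\<^sup>2\<close>, represent different Frobenius orbits.\<close>
  define e where "e i = (if i = 0 then 1 else if i = 1 then 5 else 2 :: nat)" for i :: nat
  let ?f1 = "\<lambda>a. \<lambda>i\<in>{..<2}. lin_eval id (\<lambda>p. ((-1) ^ i) ^ snd p) (a \<circ> elem)"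
  let ?f2 = "\<lambda>a. \<lambda>i\<in>{..<3}. lin_eval \<iota> (\<lambda>p. (z ^ e i) ^ snd p) (a \<circ> elem)"
  let ?f3 = "\<lambda>a. \<lambda>i\<in>{..<2}. quat_rep id (\<alpha> i) (\<delta> i) (a \<circ> elem)"
  let ?f4 = "\<lambda>a. quat_rep \<iota> \<alpha>' \<delta>' (a \<circ> elem)"
  let ?f = "\<lambda>a. (?f1 a, ?f2 a, ?f3 a, ?f4 a)"
  have "?f1 \<in> unital_hom ?FG ?B1"
    by (rule group_power_character_hom[OF field_hom_id m1(1)]) simp
  moreover have "?f2 \<in> unital_hom ?FG ?B2"
    by (rule group_power_character_hom[OF \<iota> z8i]) simp
  moreover have "?f3 \<in> unital_hom ?FG ?B3"
    by (rule group_power_quat_rep_hom[OF field_hom_id norm m1(2)])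
  moreover have "?f4 \<in> unital_hom ?FG ?B4"
    by (rule quat_rep_hom[OF \<iota> norm' z24])
  ultimately have hom: "?f \<in> unital_hom ?FG ?B" by (intro unital_hom_DirProd)
  have "units_of ?FG \<cong> units_of ?B"
  proof (rule units_group_algebra_iso[OF hom])
    fix a b :: "'a \<Rightarrow> 'f" and p
    assume eq: "?f a = ?f b" and p: "p \<in> exponents"
    let ?d = "\<lambda>p. a (elem p) - b (elem p)"
    let ?r = "CARD('f) mod 8"
    have zq: "(z ^ i) ^ CARD('f) = z ^ (i * ?r mod 8)" for i
    proof -
      have "(z ^ i) ^ CARD('f) = z ^ (8 * (i * CARD('f) div 8) + i * CARD('f) mod 8)"
        by (simp flip: power_mult)
      also have "\<dots> = z ^ (i * CARD('f) mod 8)" by (simp only: power_add power_mult z8 power_one mult_1)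
      finally show ?thesis by (simp add: mod_mult_right_eq)
    qed
    note conj = vanish_conjugate[OF \<iota> char, where a = ?d]
    have "char_vanish id ((-1) ^ i) ?d" if "i < 2" for i
      by (rule character_family_vanish[OF field_hom_id _ that]) (use eq in blast)
    from char_vanish_field_hom[OF \<iota> this] have "char_vanish \<iota> ((-1) ^ i) ?d" if "i < 2" for i
      using that by (simp add: \<iota>.hom_power \<iota>.hom_uminus)
    \<comment> \<open>The character values 1 and -1 over F are z^0 and z^4 in the extension.\<close>
    from this[of 0] this[of 1] have F: "char_vanish \<iota> (z ^ 0) ?d" "char_vanish \<iota> (z ^ 4) ?d"
      by (simp_all add: z)
    have "char_vanish \<iota> (z ^ e i) ?d" if "i < 3" for i
      by (rule character_family_vanish[OF \<iota> _ that]) (use eq in blast)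
    from this[of 0] this[of 1] this[of 2]
    have E: "char_vanish \<iota> (z ^ 1) ?d" "char_vanish \<iota> (z ^ 5) ?d" "char_vanish \<iota> (z ^ 2) ?d"
      by (simp_all add: e_def)
    have ch: "char_vanish \<iota> (z ^ i) ?d" if "i < 8" for i
    proof -
      from that consider "i = 0" | "i = 1" | "i = 2" | "i = 3" | "i = 4" | "i = 5" | "i = 6" | "i = 7" by linarith
      then show ?thesis
        using F E conj(1)[OF E(1), unfolded zq] conj(1)[OF E(2), unfolded zq] conj(1)[OF E(3), unfolded zq] q
        by cases auto
    qed
    have "quat_vanish id ((-1) ^ i) ?d" if "i < 2" for i
      by (rule quat_family_vanish[OF field_hom_id three norm m1(2) _ that]) (use eq in blast)
    from quat_vanish_field_hom[OF \<iota> this] have "quat_vanish \<iota> ((-1) ^ i) ?d" if "i < 2" for i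
      using that by (simp add: \<iota>.hom_power \<iota>.hom_uminus)
    from this[of 0] this[of 1] have F': "quat_vanish \<iota> (z ^ 0) ?d" "quat_vanish \<iota> (z ^ 4) ?d"
      by (simp_all add: z)
    have "z ^ 2 \<noteq> 0" using z24 by auto
    then have E': "quat_vanish \<iota> (z ^ 2) ?d"
      using quat_vanish_if_eq[OF \<iota> norm' _ threeE, of "a \<circ> elem" "b \<circ> elem"] eq by simp
    have "quat_vanish \<iota> (z ^ (2 * i)) ?d" if "i < 4" for i
    proof -
      from that consider "i = 0" | "i = 1" | "i = 2" | "i = 3" by linarith
      then show ?thesis
        using F' E' conj(2)[OF E', unfolded zq] q by cases auto
    qed
    with ch have "?d p = 0"
      by (intro coeffs_eq_0_if_vanish[OF \<iota> z twoE threeE _ _ p])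
    then show "a (elem p) = b (elem p)" by simp
  next
    have 1: "finite (carrier ?B1)" "card (carrier ?B1) = CARD('f) ^ 2"
      using card_group_power[of "ring_on (UNIV :: 'f set)"] by (simp_all add: ring_on_def)
    have 2: "finite (carrier ?B2)" "card (carrier ?B2) = CARD('f) ^ 6"
      using card_group_power[of "ring_on (UNIV :: 'e set)"] finE cardE
      by (simp_all add: ring_on_def flip: power_mult)
    note 3 = card_group_power_ring_mat[where 'k = 'f and m = 2, OF finite]
    have 4: "finite (carrier ?B4)" "card (carrier ?B4) \<le> CARD('f) ^ 8"
      using finite_carrier_mat_2_2[OF finE] cardE by (simp_all add: ring_mat_simps flip: power_mult)
    show "finite (carrier ?B)" using 1 2 3(1) 4(1) by simp
    have "card (carrier ?B) = CARD('f) ^ 2 * (CARD('f) ^ 6 * (card (carrier ?B3) * card (carrier ?B4)))"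
      by (simp add: card_cartesian_product 1(2) 2(2))
    also have "\<dots> \<le> CARD('f) ^ 2 * (CARD('f) ^ 6 * (CARD('f) ^ (4 * 2) * CARD('f) ^ 8))"
      by (intro mult_le_mono le_refl 3(2) 4(2))
    also have "\<dots> = CARD('f) ^ 24" by (simp flip: power_add)
    finally show "card (carrier ?B) \<le> CARD('f) ^ 24" .
  qed
  also have "units_of ?B \<cong>
    group_power (integer_mod_group (CARD('f) - 1)) 2 \<times>\<times>
    group_power (integer_mod_group (CARD('e) - 1)) 3 \<times>\<times>
    group_power (general_linear_group 2 TYPE('f)) 2 \<times>\<times>
    general_linear_group 2 TYPE('e)"
    unfolding units_of_DirProd units_group_power_ring_mat general_linear_group_def[of 2 "TYPE('e)", symmetric]
    by (intro group.DirProd_iso_trans units_group_power_ring_on_iso finite_subring_UNIV iso_refl finite finE)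
  finally show ?thesis unfolding cardE .
qed

end

section \<open>A quadratic extension inside a larger field\<close>

lemma finite_subring_sum:
  assumes "finite_subring S" "\<And>i. i \<in> A \<Longrightarrow> f i \<in> S"
  shows "sum f A \<in> S"
  using assms(2) by (induction A rule: infinite_finite_induct) (use assms(1) in \<open>auto simp: finite_subring_def\<close>)

lemma finite_subring_power: "finite_subring S \<Longrightarrow> x \<in> S \<Longrightarrow> x ^ n \<in> S"
  by (induction n) (auto simp: finite_subring_def)

text \<open>The set is F(z) for a square root z of an element of F; products stay inside because z^2
  is in F.\<close>

lemma finite_subring_adjoin_sqrt:
  fixes \<iota> :: "'f::{field,finite} \<Rightarrow> 'e::field"
  assumes \<iota>: "field_hom \<iota>" and z: "z ^ 2 = \<iota> w"
  shows "finite_subring {\<iota> u + \<iota> v * z | u v. True}"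
proof -
  interpret field_hom \<iota> by fact
  let ?S = "{\<iota> u + \<iota> v * z | u v. True}"
  have "?S = range (\<lambda>(u, v). \<iota> u + \<iota> v * z)" by auto
  then have "finite ?S" by simp
  moreover have "0 \<in> ?S" by (rule CollectI, rule exI[of _ 0], rule exI[of _ 0]) simp
  moreover have "1 \<in> ?S" by (rule CollectI, rule exI[of _ 1], rule exI[of _ 0]) simp
  moreover have "s + t \<in> ?S \<and> s * t \<in> ?S" if "s \<in> ?S" "t \<in> ?S" for s t
  proof -
    from that obtain u v u' v' where st: "s = \<iota> u + \<iota> v * z" "t = \<iota> u' + \<iota> v' * z" by blast
    have "s + t = \<iota> (u + u') + \<iota> (v + v') * z" by (simp add: st hom_add algebra_simps)
    moreover have "s * t = \<iota> (u * u' + v * v' * w) + \<iota> (u * v' + v * u') * z"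
      by (simp add: st hom_add hom_mult z[symmetric] power2_eq_square algebra_simps)
    ultimately show ?thesis by blast
  qed
  moreover have "-s \<in> ?S" if "s \<in> ?S" for s
  proof -
    from that obtain u v where "s = \<iota> u + \<iota> v * z" by blast
    then have "-s = \<iota> (-u) + \<iota> (-v) * z" by (simp add: hom_uminus)
    then show ?thesis by blast
  qed
  ultimately show ?thesis by (simp add: finite_subring_def)
qed

text \<open>Two representations with different coefficients of z would express z as a quotient of
  elements of F.\<close>

lemma card_adjoin_sqrt:
  fixes \<iota> :: "'f::{field,finite} \<Rightarrow> 'e::field"
  assumes \<iota>: "field_hom \<iota>" and z: "z \<notin> range \<iota>"
  shows "card {\<iota> u + \<iota> v * z | u v. True} = CARD('f) ^ 2"
proof -
  interpret field_hom \<iota> by fact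
  let ?g = "\<lambda>(u, v). \<iota> u + \<iota> v * z"
  have "inj ?g"
  proof (rule injI)
    fix s t assume eq: "?g s = ?g t"
    obtain u v u' v' where st: "s = (u, v)" "t = (u', v')" by fastforce
    have eq': "\<iota> (v - v') * z = \<iota> (u' - u)" using eq by (simp add: st hom_minus algebra_simps)
    have "v = v'"
    proof (rule ccontr)
      assume "v \<noteq> v'"
      then have "\<iota> (v - v') \<noteq> 0" by simp
      then have "z = \<iota> (u' - u) / \<iota> (v - v')" using eq' by (simp add: field_simps)
      also have "\<dots> = \<iota> ((u' - u) / (v - v'))" by (simp add: hom_div)
      finally show False using z by blast
    qed
    then show "s = t" using eq' by (simp add: st hom_minus)
  qed
  moreover have "{\<iota> u + \<iota> v * z | u v. True} = range ?g" by auto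
  ultimately show ?thesis by (simp add: card_image power2_eq_square)
qed

context C3_rtimes_C8
begin

text \<open>F contains the fourth roots of unity, hence every c and every even power of z. The odd
  exponents form the orbits {1, 5} and {3, 7}. The dimensions give 4 + 2 * 2 + 4 * 4 = 24.\<close>

lemma units_iso_if_card_mod_8_eq_5:
  fixes \<iota> :: "'f::{field,finite} \<Rightarrow> 'e::field" and z :: 'e
  assumes \<iota>: "field_hom \<iota>" and char: "Factorial_Ring.prime CHAR('e)" "CARD('f) = CHAR('e) ^ k"
    and w: "w ^ 2 = -1" and z: "z ^ 2 = \<iota> w" and two: "(2::'f) \<noteq> 0" and three: "(3::'f) \<noteq> 0"
    and q: "CARD('f) mod 8 = 5"
  shows "units_of (group_algebra TYPE('f) G) \<cong>
    group_power (integer_mod_group (CARD('f) - 1)) 4 \<times>\<times>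
    group_power (integer_mod_group (CARD('f) ^ 2 - 1)) 2 \<times>\<times>
    group_power (general_linear_group 2 TYPE('f)) 4"
proof -
  interpret \<iota>: field_hom \<iota> by fact
  define S where "S = {\<iota> u + \<iota> v * z | u v. True}"
  let ?FG = "group_algebra TYPE('f) G"
  let ?B1 = "group_power (ring_on (UNIV :: 'f set)) 4" and ?B2 = "group_power (ring_on S) 2"
  let ?B3 = "group_power (ring_mat TYPE('f) 2 ()) 4"
  let ?B = "?B1 \<times>\<times> ?B2 \<times>\<times> ?B3"
  have twoE: "(2::'e) \<noteq> 0" using two \<iota>.hom_0_iff[of 2] by (simp add: \<iota>.hom_numeral)
  have threeE: "(3::'e) \<noteq> 0" using three \<iota>.hom_0_iff[of 3] by (simp add: \<iota>.hom_numeral)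
  obtain \<alpha> \<delta> :: "nat \<Rightarrow> 'f" where norm: "\<And>i. \<alpha> i * \<alpha> i - \<alpha> i * \<delta> i + \<delta> i * \<delta> i = w ^ i"
    by (rule ex_norm_family[OF finite two three, where c = "\<lambda>i. w ^ i"]) blast
  have z4: "z ^ 4 = -1"
    using power_mult[of z 2 2] z w by (simp add: \<iota>.hom_uminus flip: \<iota>.hom_power)
  have z8: "z ^ 8 = 1" using power_mult[of z 4 2] z4 by simp
  have z8i: "(z ^ i) ^ 8 = 1" for i
    using power_mult[of z 8 i] z8 by (simp add: mult_ac flip: power_mult)
  have w4: "w ^ 4 = 1" using power_mult[of w 2 2] w by simp
  have w4i: "(w ^ i) ^ 4 = 1" for i
    using power_mult[of w 4 i] w4 by (simp add: mult_ac flip: power_mult)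
  have w8i: "(w ^ i) ^ 8 = 1" for i
    using power_mult[of "w ^ i" 4 2] w4i by simp
  have zq: "(z ^ i) ^ CARD('f) = z ^ (i * 5 mod 8)" for i
  proof -
    have "(z ^ i) ^ CARD('f) = z ^ (8 * (i * CARD('f) div 8) + i * CARD('f) mod 8)"
      by (simp flip: power_mult)
    also have "\<dots> = z ^ (i * CARD('f) mod 8)" by (simp only: power_add power_mult z8 power_one mult_1)
    finally show ?thesis using mod_mult_right_eq[of i "CARD('f)" 8] q by simp
  qed
  \<comment> \<open>Elements of F are fixed by the q-th power, whereas z^q = z^5 = -z.\<close>
  have "z \<notin> range \<iota>"
  proof
    assume "z \<in> range \<iota>"
    then obtain t where "z = \<iota> t" by blast
    then have "z ^ CARD('f) = z" by (simp add: finite_field_power_card flip: \<iota>.hom_power)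
    moreover have "z ^ CARD('f) = - z" using zq[of 1] z4 power_Suc[of z 4] by simp
    ultimately have "2 * z = 0" by (metis add.right_inverse mult_2)
    then show False using twoE z4 by simp
  qed
  then have cardS: "card S = CARD('f) ^ 2" unfolding S_def by (rule card_adjoin_sqrt[OF \<iota>])
  have S: "finite_subring S" unfolding S_def by (rule finite_subring_adjoin_sqrt[OF \<iota> z])
  have zS: "z \<in> S" unfolding S_def by (rule CollectI, rule exI[of _ 0], rule exI[of _ 1]) simp
  have \<iota>S: "\<iota> t \<in> S" for t unfolding S_def by (rule CollectI, rule exI[of _ t], rule exI[of _ 0]) simp
  have evalS: "lin_eval \<iota> (\<lambda>p. (z ^ i) ^ snd p) c \<in> S" for i c
    unfolding lin_eval_def
    using finite_subring_power[OF S finite_subring_power[OF S zS]] \<iota>S S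
    by (intro finite_subring_sum[OF S]) (simp add: finite_subring_def)
  let ?f1 = "\<lambda>a. \<lambda>i\<in>{..<4}. lin_eval id (\<lambda>p. (w ^ i) ^ snd p) (a \<circ> elem)"
  let ?f2 = "\<lambda>a. \<lambda>i\<in>{..<2}. lin_eval \<iota> (\<lambda>p. (z ^ (2 * i + 1)) ^ snd p) (a \<circ> elem)"
  let ?f3 = "\<lambda>a. \<lambda>i\<in>{..<4}. quat_rep id (\<alpha> i) (\<delta> i) (a \<circ> elem)"
  let ?f = "\<lambda>a. (?f1 a, ?f2 a, ?f3 a)"
  have "?f1 \<in> unital_hom ?FG ?B1"
    by (rule group_power_character_hom[OF field_hom_id w8i]) simp
  moreover have "?f2 \<in> unital_hom ?FG ?B2"
    by (rule group_power_character_hom[OF \<iota> z8i evalS])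
  moreover have "?f3 \<in> unital_hom ?FG ?B3"
    by (rule group_power_quat_rep_hom[OF field_hom_id norm w4i])
  ultimately have hom: "?f \<in> unital_hom ?FG ?B" by (intro unital_hom_DirProd)
  have "units_of ?FG \<cong> units_of ?B"
  proof (rule units_group_algebra_iso[OF hom])
    fix a b :: "'a \<Rightarrow> 'f" and p
    assume eq: "?f a = ?f b" and p: "p \<in> exponents"
    let ?d = "\<lambda>p. a (elem p) - b (elem p)"
    have \<iota>w: "\<iota> (w ^ i) = z ^ (2 * i)" for i by (simp add: \<iota>.hom_power z power_mult)
    have "char_vanish id (w ^ i) ?d" if "i < 4" for i
      by (rule character_family_vanish[OF field_hom_id _ that]) (use eq in blast)
    from char_vanish_field_hom[OF \<iota> this]
    have even: "char_vanish \<iota> (z ^ (2 * i)) ?d" if "i < 4" for i using that by (simp only: \<iota>w)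
    have "char_vanish \<iota> (z ^ (2 * i + 1)) ?d" if "i < 2" for i
      by (rule character_family_vanish[OF \<iota> _ that]) (use eq in blast)
    from this[of 0] this[of 1] have odd: "char_vanish \<iota> (z ^ 1) ?d" "char_vanish \<iota> (z ^ 3) ?d"
      by (simp_all add: numeral_3_eq_3)
    note conj = odd[THEN vanish_conjugate(1)[OF \<iota> char, where a = ?d], unfolded zq]
    have ch: "char_vanish \<iota> (z ^ i) ?d" if "i < 8" for i
    proof -
      from that consider "i = 0" | "i = 1" | "i = 2" | "i = 3" | "i = 4" | "i = 5" | "i = 6" | "i = 7" by linarith
      then show ?thesis
        using even[of 0] even[of 1] even[of 2] even[of 3] odd conj by cases auto
    qed
    have "quat_vanish id (w ^ i) ?d" if "i < 4" for i
      by (rule quat_family_vanish[OF field_hom_id three norm w4i _ that]) (use eq in blast)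
    from quat_vanish_field_hom[OF \<iota> this]
    have "quat_vanish \<iota> (z ^ (2 * i)) ?d" if "i < 4" for i using that by (simp only: \<iota>w)
    with ch have "?d p = 0"
      by (intro coeffs_eq_0_if_vanish[OF \<iota> z4 twoE threeE _ _ p])
    then show "a (elem p) = b (elem p)" by simp
  next
    have 1: "finite (carrier ?B1)" "card (carrier ?B1) = CARD('f) ^ 4"
      using card_group_power[of "ring_on (UNIV :: 'f set)"] by (simp_all add: ring_on_def)
    have 2: "finite (carrier ?B2)" "card (carrier ?B2) = CARD('f) ^ 4"
      using card_group_power[of "ring_on S"] S cardS
      by (simp_all add: ring_on_def finite_subring_def flip: power_mult)
    note 3 = card_group_power_ring_mat[where 'k = 'f and m = 4, OF finite]
    show "finite (carrier ?B)" using 1 2 3(1) by simp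
    have "card (carrier ?B) = CARD('f) ^ 4 * (CARD('f) ^ 4 * card (carrier ?B3))"
      by (simp add: card_cartesian_product 1(2) 2(2))
    also have "\<dots> \<le> CARD('f) ^ 4 * (CARD('f) ^ 4 * CARD('f) ^ (4 * 4))"
      by (intro mult_le_mono le_refl 3(2))
    also have "\<dots> = CARD('f) ^ 24" by (simp flip: power_add)
    finally show "card (carrier ?B) \<le> CARD('f) ^ 24" .
  qed
  also have "units_of ?B \<cong>
    group_power (integer_mod_group (CARD('f) - 1)) 4 \<times>\<times>
    group_power (integer_mod_group (card S - 1)) 2 \<times>\<times>
    group_power (general_linear_group 2 TYPE('f)) 4"
    unfolding units_of_DirProd units_group_power_ring_mat
    by (intro group.DirProd_iso_trans units_group_power_ring_on_iso finite_subring_UNIV iso_refl finite S)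
  finally show ?thesis unfolding cardS .
qed

end

section \<open>Choice of the roots of unity in each case\<close>

lemma ex_power_eq_minus_1:
  assumes fin: "finite (UNIV :: 'k::field set)" and d: "2 * d dvd CARD('k) - 1"
  shows "\<exists>z::'k. z ^ d = -1"
proof -
  obtain t where t: "CARD('k) - 1 = 2 * d * t" using d by (elim dvdE)
  \<comment> \<open>Having at least two elements makes \<open>CARD('k) - 1\<close> positive, hence
    also \<open>d * t\<close>.\<close>
  have "card {0, 1 :: 'k} \<le> CARD('k)" by (rule card_mono[OF fin]) simp
  then have "d * t > 0" using t by (cases "d * t") auto
  then obtain z :: 'k where "z ^ (d * t) = -1"
    using ex_half_power_eq_minus_1[OF fin, of "d * t"] t by (auto simp: mult_ac)
  then have "(z ^ t) ^ d = -1" by (simp add: mult.commute flip: power_mult)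
  then show ?thesis by blast
qed

lemma field_hom_to_ac: "field_hom (to_ac :: 'f::field \<Rightarrow> 'f alg_closure)"
  by unfold_locales auto

theorem theorem2p5:
  fixes G :: "('g, 'm) monoid_scheme"
    and p k q :: nat
  assumes "CHAR('f::{field, finite}) = p"
    and "CARD('f) = q" and "q = p ^ k"
    and "is_C3_rtimes_C8 G"
    and "p > 3"
  shows
    "([int q = 1] (mod 24) \<or> [int q = -7] (mod 24) \<longrightarrow>
        units_of (group_algebra TYPE('f) G) \<cong>
          group_power (integer_mod_group (p ^ k - 1)) 8 \<times>\<times>
          group_power (general_linear_group 2 TYPE('f)) 4) \<and>
     ([int q = -1] (mod 24) \<or> [int q = -5] (mod 24) \<or> [int q = 7] (mod 24) \<or> [int q = 11] (mod 24) \<longrightarrow>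
        (\<forall>\<iota> :: 'f \<Rightarrow> 'f2::field. is_extension_of_degree 2 \<iota> \<longrightarrow>
          units_of (group_algebra TYPE('f) G) \<cong>
            group_power (integer_mod_group (p ^ k - 1)) 2 \<times>\<times>
            group_power (integer_mod_group (p ^ (2 * k) - 1)) 3 \<times>\<times>
            group_power (general_linear_group 2 TYPE('f)) 2 \<times>\<times>
            general_linear_group 2 TYPE('f2))) \<and>
     ([int q = 5] (mod 24) \<or> [int q = -11] (mod 24) \<longrightarrow>
        units_of (group_algebra TYPE('f) G) \<cong>
          group_power (integer_mod_group (p ^ k - 1)) 4 \<times>\<times>
          group_power (integer_mod_group (p ^ (2 * k) - 1)) 2 \<times>\<times>
          group_power (general_linear_group 2 TYPE('f)) 4)"
proof -
  obtain x y where "C3_rtimes_C8 G x y"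
    using assms(4) unfolding is_C3_rtimes_C8_def by (auto intro: C3_rtimes_C8.intro C3_rtimes_C8_axioms.intro)
  then interpret C3_rtimes_C8 G x y .
  have prime: "Factorial_Ring.prime CHAR('f)"
    using assms(1,5) by (intro prime_CHAR_semidom) simp
  have card: "CARD('f) = p ^ k" and card2: "p ^ (2 * k) = CARD('f) ^ 2"
    using assms(2,3) by (simp_all add: mult.commute flip: power_mult)
  have nz: "of_nat n \<noteq> (0::'f)" if "0 < n" "n \<le> 3" for n
    using that assms(1,5) by (auto simp: of_nat_eq_0_iff_char_dvd dest: dvd_imp_le)
  have two: "(2::'f) \<noteq> 0" and three: "(3::'f) \<noteq> 0" using nz[of 2] nz[of 3] by simp_all
  \<comment> \<open>As 8 divides 24, each listed residue determines q modulo 8.\<close>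
  have q_mod_8: "int (q mod 8) = int q mod 24 mod 8"
    by (simp add: zmod_int mod_mod_cancel)
  show ?thesis
  proof (intro conjI impI allI)
    assume "[int q = 1] (mod 24) \<or> [int q = -7] (mod 24)"
    then have "q mod 8 = 1" using q_mod_8 by (auto simp: cong_def)
    then have "2 * 4 dvd CARD('f) - 1" unfolding assms(2) by presburger
    then obtain z :: 'f where "z ^ 4 = -1" using ex_power_eq_minus_1[OF finite] by blast
    from units_iso_if_eighth_root[OF this two three]
    show "units_of (group_algebra TYPE('f) G) \<cong>
        group_power (integer_mod_group (p ^ k - 1)) 8 \<times>\<times> group_power (general_linear_group 2 TYPE('f)) 4"
      unfolding card .
  next
    fix \<iota> :: "'f \<Rightarrow> 'f2"
    assume "[int q = -1] (mod 24) \<or> [int q = -5] (mod 24) \<or> [int q = 7] (mod 24) \<or> [int q = 11] (mod 24)"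
      and ext: "is_extension_of_degree 2 \<iota>"
    then have q8: "CARD('f) mod 8 = 3 \<or> CARD('f) mod 8 = 7" using q_mod_8 by (auto simp: cong_def assms(2))
    note cardE = card_extension_of_degree_2[OF ext]
    have \<iota>: "field_hom \<iota>" using ext by (simp add: is_extension_of_degree_def)
    \<comment> \<open>The square of an odd number is 1 modulo 8, so the quadratic extension has a
      root of t^4 = -1.\<close>
    have "CARD('f) ^ 2 mod 8 = 1"
      using q8 power_mod[of "CARD('f)" 8 2] by auto
    then have "2 * 4 dvd CARD('f2) - 1" unfolding cardE(2) by presburger
    then obtain z :: 'f2 where "z ^ 4 = -1" using ex_power_eq_minus_1[OF cardE(1)] by blast
    from units_iso_if_card_mod_8_eq_3_or_7[OF \<iota> _ _ cardE this two three q8] prime card assms(1)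
    show "units_of (group_algebra TYPE('f) G) \<cong>
          group_power (integer_mod_group (p ^ k - 1)) 2 \<times>\<times>
          group_power (integer_mod_group (p ^ (2 * k) - 1)) 3 \<times>\<times>
          group_power (general_linear_group 2 TYPE('f)) 2 \<times>\<times>
          general_linear_group 2 TYPE('f2)"
      unfolding card2 by (simp add: CHAR_field_hom[OF \<iota>])
  next
    assume "[int q = 5] (mod 24) \<or> [int q = -11] (mod 24)"
    then have q8: "CARD('f) mod 8 = 5" using q_mod_8 by (auto simp: cong_def assms(2))
    then have "2 * 2 dvd CARD('f) - 1" by presburger
    then obtain w :: 'f where w: "w ^ 2 = -1" using ex_power_eq_minus_1[OF finite] by blast
    \<comment> \<open>F has a square root w of -1 but no eighth root of unity of exact order 8, so z
      is taken from the algebraic closure.\<close>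
    obtain z :: "'f alg_closure" where "z ^ 2 = to_ac w" using nth_root_exists[of 2 "to_ac w"] by auto
    from units_iso_if_card_mod_8_eq_5[OF field_hom_to_ac _ _ w this two three q8] prime card assms(1)
    show "units_of (group_algebra TYPE('f) G) \<cong>
          group_power (integer_mod_group (p ^ k - 1)) 4 \<times>\<times>
          group_power (integer_mod_group (p ^ (2 * k) - 1)) 2 \<times>\<times>
          group_power (general_linear_group 2 TYPE('f)) 4"
      unfolding card2 by simp
  qed
qed

end
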